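(* Let $H$ be a weak Hopf algebra with bijective antipode over a commutative ring $k$, finitely generated and projective as a $k$-module. Let $p:H\bowtie H^*\to H\bowtie H^*$ be the projection $p(x)=(1\bowtie\varepsilon)x=x(1\bowtie\varepsilon)$. Then $\mathrm{Ker}(p)$ is the $k$-linear span of the elements of the form $$hz\bowtie h^*-h\bowtie (z\rightharpoonup\varepsilon)*h^*\quad\text{and}\quad hy\bowtie h^*-h\bowtie(\varepsilon\leftharpoonup y)*h^*,$$ where $h\in H$, $h^*\in H^*$, $y\in H_s$ and $z\in H_t$.
   Context: $\otimes=\otimes_k$. A weak $k$-bialgebra is a $k$-module $H$ with a unital associative algebra structure and a coassociative counital coalgebra structure $(\Delta,\varepsilon)$, $\Delta(h)=h_{(1)}\otimes h_{(2)}$, such that $\Delta(hk)=\Delta(h)\Delta(k)$, $(\Delta\otimes H)\Delta(1)=1_{(1)}\otimes 1_{(2)}1_{(1')}\otimes 1_{(2')}=1_{(1)}\otimes 1_{(1')}1_{(2)}\otimes 1_{(2')}$, $\varepsilon(hkl)=\varepsilon(hk_{(1)})\varepsilon(k_{(2)}l)=\varepsilon(hk_{(2)})\varepsilon(k_{(1)}l)$. Put $\varepsilon_t(h)=\varepsilon(1_{(1)}h)1_{(2)}$, $\varepsilon_s(h)=1_{(1)}\varepsilon(h1_{(2)})$, $H_t=\mathrm{Im}(\varepsilon_t)$, $H_s=\mathrm{Im}(\varepsilon_s)$. A weak Hopf algebra is a weak bialgebra with a $k$-linear antipode $S$ such that $S(h_{(1)})h_{(2)}=\varepsilon_s(h)$,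 $h_{(1)}S(h_{(2)})=\varepsilon_t(h)$, $S(h_{(1)})h_{(2)}S(h_{(3)})=S(h)$. $H^*=\mathrm{Hom}_k(H,k)$ has the convolution product $\langle h^**k^*,h\rangle=\langle h^*,h_{(1)}\rangle\langle k^*,h_{(2)}\rangle$ with unit $\varepsilon$, and is an $H$-bimodule by $\langle h\rightharpoonup h^*\leftharpoonup k,l\rangle=\langle h^*,klh\rangle$. $H\bowtie H^*$ is the $k$-module $H\otimes H^*$ with the associative multiplication $$(h\bowtie h^* )(k\bowtie k^* )=hk_{(2)}\bowtie\bigl(S^{-1}(k_{(1)})\rightharpoonup h^*\leftharpoonup k_{(3)}\bigr)*k^*.$$ It has preunit $e=1\bowtie\varepsilon$, meaning $ex=xe=xe^2$ for all $x$; hence $p$ is well defined and $p\circ p=p$. (The Drinfeld double of $H$ is $D(H)=(H\bowtie H^* )/\mathrm{Ker}(p)$.) *)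

theory Defs
  imports Complex_Main "HOL-Library.Poly_Mapping" "HOL-Library.Function_Algebras"
begin

section \<open>Tensor products of modules over a commutative ring\<close>

text \<open>
  A tensor product is constructed as the quotient of the free module on the pure tensors by the
  submodule of multilinearity relations. A tensor is a coset, so equality of tensors is equality
  of sets. The factors may be submodules (carrier sets) of the ambient types; this is needed
  for the dual module, which is a set of functions.
\<close>

definition free_scale :: "'k::comm_ring_1 \<Rightarrow> ('g \<Rightarrow>\<^sub>0 'k) \<Rightarrow> ('g \<Rightarrow>\<^sub>0 'k)" where
  "free_scale c = Poly_Mapping.map ((*) c)"

lemma lookup_free_scale [simp]:
  "Poly_Mapping.lookup (free_scale c x) g = c * Poly_Mapping.lookup x g"
  by (simp add: free_scale_def Poly_Mapping.map.rep_eq when_def)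

interpretation free_module: module "free_scale :: 'k::comm_ring_1 \<Rightarrow> ('g \<Rightarrow>\<^sub>0 'k) \<Rightarrow> ('g \<Rightarrow>\<^sub>0 'k)"
  by unfold_locales (auto intro!: poly_mapping_eqI simp: lookup_add algebra_simps)

text \<open>The linear extension of a map \<open>f\<close> given on the basis of a free module.\<close>

definition lin_ext ::
    "('k::comm_ring_1 \<Rightarrow> 'v \<Rightarrow> 'v::ab_group_add) \<Rightarrow> ('g \<Rightarrow> 'v) \<Rightarrow> ('g \<Rightarrow>\<^sub>0 'k) \<Rightarrow> 'v" where
  "lin_ext s f x = (\<Sum>g\<in>Poly_Mapping.keys x. s (Poly_Mapping.lookup x g) (f g))"

text \<open>The relations making the generator \<open>ins a\<close> depend linearly on \<open>a \<in> A\<close>.\<close>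

definition linear_rels ::
    "('k::comm_ring_1 \<Rightarrow> 'a \<Rightarrow> 'a::ab_group_add) \<Rightarrow> 'a set \<Rightarrow> ('a \<Rightarrow> 'g) \<Rightarrow> ('g \<Rightarrow>\<^sub>0 'k) set" where
  "linear_rels s A ins =
     {Poly_Mapping.single (ins (a + a')) 1
        - (Poly_Mapping.single (ins a) 1 + Poly_Mapping.single (ins a') 1) | a a'. a \<in> A \<and> a' \<in> A}
   \<union> {Poly_Mapping.single (ins (s c a)) 1
        - free_scale c (Poly_Mapping.single (ins a) 1) | c a. a \<in> A}"

definition rel2 ::
    "('k::comm_ring_1 \<Rightarrow> 'a \<Rightarrow> 'a::ab_group_add) \<Rightarrow> 'a set \<Rightarrow>
     ('k \<Rightarrow> 'b \<Rightarrow> 'b::ab_group_add) \<Rightarrow> 'b set \<Rightarrow> ('a \<times> 'b \<Rightarrow>\<^sub>0 'k) set" where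
  "rel2 sA A sB B = free_module.span
     ((\<Union>b\<in>B. linear_rels sA A (\<lambda>a. (a, b))) \<union> (\<Union>a\<in>A. linear_rels sB B (\<lambda>b. (a, b))))"

definition rel3 :: "('k::comm_ring_1 \<Rightarrow> 'a \<Rightarrow> 'a::ab_group_add) \<Rightarrow> ('a \<times> 'a \<times> 'a \<Rightarrow>\<^sub>0 'k) set" where
  "rel3 s = free_module.span
     ((\<Union>b. \<Union>c. linear_rels s UNIV (\<lambda>a. (a, b, c)))
    \<union> (\<Union>a. \<Union>c. linear_rels s UNIV (\<lambda>b. (a, b, c)))
    \<union> (\<Union>a. \<Union>b. linear_rels s UNIV (\<lambda>c. (a, b, c))))"

definition coset :: "('g \<Rightarrow>\<^sub>0 'k::comm_ring_1) set \<Rightarrow> ('g \<Rightarrow>\<^sub>0 'k) \<Rightarrow> ('g \<Rightarrow>\<^sub>0 'k) set" where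
  "coset R x = {y. y - x \<in> R}"

definition tensor2 ::
    "('k::comm_ring_1 \<Rightarrow> 'a \<Rightarrow> 'a::ab_group_add) \<Rightarrow> 'a set \<Rightarrow>
     ('k \<Rightarrow> 'b \<Rightarrow> 'b::ab_group_add) \<Rightarrow> 'b set \<Rightarrow> ('a \<times> 'b \<Rightarrow>\<^sub>0 'k) set set" where
  "tensor2 sA A sB B = coset (rel2 sA A sB B) ` {x. Poly_Mapping.keys x \<subseteq> A \<times> B}"

definition q_add ::
    "('g \<Rightarrow>\<^sub>0 'k::comm_ring_1) set \<Rightarrow> ('g \<Rightarrow>\<^sub>0 'k) set \<Rightarrow> ('g \<Rightarrow>\<^sub>0 'k) set \<Rightarrow> ('g \<Rightarrow>\<^sub>0 'k) set" where
  "q_add R X Y = {z. \<exists>x\<in>X. \<exists>y\<in>Y. z - (x + y) \<in> R}"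

definition q_diff ::
    "('g \<Rightarrow>\<^sub>0 'k::comm_ring_1) set \<Rightarrow> ('g \<Rightarrow>\<^sub>0 'k) set \<Rightarrow> ('g \<Rightarrow>\<^sub>0 'k) set \<Rightarrow> ('g \<Rightarrow>\<^sub>0 'k) set" where
  "q_diff R X Y = {z. \<exists>x\<in>X. \<exists>y\<in>Y. z - (x - y) \<in> R}"

definition q_scale ::
    "('g \<Rightarrow>\<^sub>0 'k::comm_ring_1) set \<Rightarrow> 'k \<Rightarrow> ('g \<Rightarrow>\<^sub>0 'k) set \<Rightarrow> ('g \<Rightarrow>\<^sub>0 'k) set" where
  "q_scale R c X = {z. \<exists>x\<in>X. z - free_scale c x \<in> R}"

inductive_set q_span ::
    "('g \<Rightarrow>\<^sub>0 'k::comm_ring_1) set \<Rightarrow> ('g \<Rightarrow>\<^sub>0 'k) set set \<Rightarrow> ('g \<Rightarrow>\<^sub>0 'k) set set"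
  for R :: "('g \<Rightarrow>\<^sub>0 'k::comm_ring_1) set" and G :: "('g \<Rightarrow>\<^sub>0 'k) set set" where
  q_span_zero: "coset R 0 \<in> q_span R G"
| q_span_base: "X \<in> G \<Longrightarrow> X \<in> q_span R G"
| q_span_add: "X \<in> q_span R G \<Longrightarrow> Y \<in> q_span R G \<Longrightarrow> q_add R X Y \<in> q_span R G"
| q_span_scale: "X \<in> q_span R G \<Longrightarrow> q_scale R c X \<in> q_span R G"

text \<open>
  \<open>t_lift s f X\<close> applies to the tensor \<open>X\<close> the linear map that is \<open>f\<close> on pure tensors:
  it evaluates at a chosen representative. With \<open>X = \<Delta> h\<close> this is Sweedler notation, i.e. the
  sum of \<open>f (h\<^sub>1, h\<^sub>2)\<close>. The value does not depend on the representative when \<open>f\<close> is multilinear;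
  when \<open>f\<close> takes values in a free module and is multilinear only modulo relations \<open>R\<close>, the
  result is meaningful modulo \<open>R\<close>, and is used below only inside \<open>coset R\<close> or another lift.
\<close>

definition rep :: "('g \<Rightarrow>\<^sub>0 'k::comm_ring_1) set \<Rightarrow> ('g \<Rightarrow>\<^sub>0 'k)" where
  "rep X = (SOME x. x \<in> X)"

definition t_lift ::
    "('k::comm_ring_1 \<Rightarrow> 'v \<Rightarrow> 'v::ab_group_add) \<Rightarrow> ('g \<Rightarrow> 'v) \<Rightarrow> ('g \<Rightarrow>\<^sub>0 'k) set \<Rightarrow> 'v" where
  "t_lift s f X = lin_ext s f (rep X)"


lemma lin_ext_mono_neutral:
  assumes "module s" "finite K" "Poly_Mapping.keys x \<subseteq> K"
  shows "lin_ext s f x = (\<Sum>g\<in>K. s (Poly_Mapping.lookup x g) (f g))"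
  unfolding lin_ext_def using assms
  by (intro sum.mono_neutral_left) (auto simp: in_keys_iff module.scale_zero_left)

lemma lin_ext_single [simp]:
  assumes "module s"
  shows "lin_ext s f (Poly_Mapping.single g c) = s c (f g)"
  using assms lin_ext_mono_neutral[OF assms, of "{g}" "Poly_Mapping.single g c" f] by simp

lemma lin_ext_linear:
  assumes s: "module s"
  shows "module_hom free_scale s (lin_ext s f)"
proof -
  interpret s: module s by fact
  show ?thesis
  proof (unfold_locales, goal_cases)
    case (1 x y)
    let ?K = "Poly_Mapping.keys x \<union> Poly_Mapping.keys y"
    have "lin_ext s f (x + y) = (\<Sum>g\<in>?K. s (Poly_Mapping.lookup (x + y) g) (f g))"
      by (rule lin_ext_mono_neutral[OF s]) (auto dest: subsetD[OF Poly_Mapping.keys_add])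
    moreover have "lin_ext s f x = (\<Sum>g\<in>?K. s (Poly_Mapping.lookup x g) (f g))"
      by (rule lin_ext_mono_neutral[OF s]) auto
    moreover have "lin_ext s f y = (\<Sum>g\<in>?K. s (Poly_Mapping.lookup y g) (f g))"
      by (rule lin_ext_mono_neutral[OF s]) auto
    ultimately show ?case
      by (simp add: lookup_add s.scale_left_distrib sum.distrib)
  next
    case (2 c x)
    have "lin_ext s f (free_scale c x)
        = (\<Sum>g\<in>Poly_Mapping.keys x. s (Poly_Mapping.lookup (free_scale c x) g) (f g))"
      by (rule lin_ext_mono_neutral[OF s]) (auto simp: in_keys_iff)
    then show ?case
      by (simp add: lin_ext_def s.scale_sum_right)
  qed
qed

text \<open>Independence of the representative in the case of two factors.\<close>

lemma t_lift_coset: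
  assumes s: "module s"
    and l_add: "\<And>a a' b. a \<in> A \<Longrightarrow> a' \<in> A \<Longrightarrow> b \<in> B \<Longrightarrow> f (a + a', b) = f (a, b) + f (a', b)"
    and l_scale: "\<And>c a b. a \<in> A \<Longrightarrow> b \<in> B \<Longrightarrow> f (sA c a, b) = s c (f (a, b))"
    and r_add: "\<And>a b b'. a \<in> A \<Longrightarrow> b \<in> B \<Longrightarrow> b' \<in> B \<Longrightarrow> f (a, b + b') = f (a, b) + f (a, b')"
    and r_scale: "\<And>c a b. a \<in> A \<Longrightarrow> b \<in> B \<Longrightarrow> f (a, sB c b) = s c (f (a, b))"
  shows "t_lift s f (coset (rel2 sA A sB B) x) = lin_ext s f x"
proof -
  interpret s: module s by fact
  interpret h: module_hom free_scale s "lin_ext s f" by (rule lin_ext_linear[OF s])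
  have zero: "lin_ext s f y = 0" if "y \<in> rel2 sA A sB B" for y
    using that unfolding rel2_def
  proof (induction rule: free_module.span_induct)
    case base
    show ?case by (auto simp: free_module.subspace_def h.zero h.add h.scale)
  next
    case (step y)
    then show ?case
      by (auto simp: linear_rels_def h.diff h.add h.scale s l_add l_scale r_add r_scale)
  qed
  have "x \<in> coset (rel2 sA A sB B) x"
    by (simp add: coset_def rel2_def free_module.span_zero)
  then have "rep (coset (rel2 sA A sB B) x) \<in> coset (rel2 sA A sB B) x"
    unfolding rep_def by (rule someI)
  then have "lin_ext s f (rep (coset (rel2 sA A sB B) x) - x) = 0"
    by (intro zero) (simp add: coset_def)
  then show ?thesis by (simp add: t_lift_def h.diff)
qed


section \<open>Finitely generated and projective modules\<close>

definition finitely_generated :: "('k::comm_ring_1 \<Rightarrow> 'a \<Rightarrow> 'a::ab_group_add) \<Rightarrow> bool" where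
  "finitely_generated s \<longleftrightarrow> (\<exists>B. finite B \<and> module.span s B = UNIV)"

text \<open>
  Projective means: a direct summand of a free module. Taking the free module on the
  underlying set of the module is no restriction, since any free module mapping onto the
  module factors through that one.
\<close>

definition projective_module :: "('k::comm_ring_1 \<Rightarrow> 'a \<Rightarrow> 'a::ab_group_add) \<Rightarrow> bool" where
  "projective_module s \<longleftrightarrow>
     (\<exists>(i :: 'a \<Rightarrow> ('a \<Rightarrow>\<^sub>0 'k)) (q :: ('a \<Rightarrow>\<^sub>0 'k) \<Rightarrow> 'a).
        module_hom s free_scale i \<and> module_hom free_scale s q \<and> (\<forall>a. q (i a) = a))"


section \<open>Weak Hopf algebras\<close>

text \<open>
  The sort \<open>{ring, monoid_mult}\<close> is that of unital rings, with the zero ring allowed.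
\<close>

locale unital_algebra = module scale
  for scale :: "'k::comm_ring_1 \<Rightarrow> 'h \<Rightarrow> 'h::{ring, monoid_mult}" +
  assumes scale_mult_left: "scale c (a * b) = scale c a * b"
    and scale_mult_right: "scale c (a * b) = a * scale c b"

abbreviation relH :: "('k::comm_ring_1 \<Rightarrow> 'h \<Rightarrow> 'h::ab_group_add) \<Rightarrow> ('h \<times> 'h \<Rightarrow>\<^sub>0 'k) set" where
  "relH scale \<equiv> rel2 scale UNIV scale UNIV"

text \<open>Sums of \<open>h\<^sub>1 \<otimes> h\<^sub>2 \<otimes> h\<^sub>3\<close>, as \<open>(\<Delta> \<otimes> H) (\<Delta> h)\<close> and as \<open>(H \<otimes> \<Delta>) (\<Delta> h)\<close>; they agree modulo \<open>rel3\<close>.\<close>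

definition comul3 ::
    "('h \<Rightarrow> ('h \<times> 'h \<Rightarrow>\<^sub>0 'k::comm_ring_1) set) \<Rightarrow> 'h \<Rightarrow> ('h \<times> 'h \<times> 'h \<Rightarrow>\<^sub>0 'k)" where
  "comul3 \<Delta> h =
     t_lift free_scale (\<lambda>(a, b).
       t_lift free_scale (\<lambda>(a1, a2). Poly_Mapping.single (a1, a2, b) 1) (\<Delta> a)) (\<Delta> h)"

definition comul3' ::
    "('h \<Rightarrow> ('h \<times> 'h \<Rightarrow>\<^sub>0 'k::comm_ring_1) set) \<Rightarrow> 'h \<Rightarrow> ('h \<times> 'h \<times> 'h \<Rightarrow>\<^sub>0 'k)" where
  "comul3' \<Delta> h =
     t_lift free_scale (\<lambda>(a, b).
       t_lift free_scale (\<lambda>(b1, b2). Poly_Mapping.single (a, b1, b2) 1) (\<Delta> b)) (\<Delta> h)"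

locale weak_bialgebra = unital_algebra scale
  for scale :: "'k::comm_ring_1 \<Rightarrow> 'h \<Rightarrow> 'h::{ring, monoid_mult}" +
  fixes \<Delta> :: "'h \<Rightarrow> ('h \<times> 'h \<Rightarrow>\<^sub>0 'k) set"
    and \<epsilon> :: "'h \<Rightarrow> 'k"
  assumes comul_tensor: "\<Delta> h \<in> tensor2 scale UNIV scale UNIV"
    and comul_add: "\<Delta> (h + l) = q_add (relH scale) (\<Delta> h) (\<Delta> l)"
    and comul_scale: "\<Delta> (scale c h) = q_scale (relH scale) c (\<Delta> h)"
    and counit_linear: "module_hom scale (*) \<epsilon>"
    and coassoc: "coset (rel3 scale) (comul3 \<Delta> h) = coset (rel3 scale) (comul3' \<Delta> h)"
    and counit_left: "t_lift scale (\<lambda>(a, b). scale (\<epsilon> a) b) (\<Delta> h) = h"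
    and counit_right: "t_lift scale (\<lambda>(a, b). scale (\<epsilon> b) a) (\<Delta> h) = h"
    and comul_mult: "\<Delta> (h * l) = coset (relH scale)
      (t_lift free_scale (\<lambda>(a, b).
        t_lift free_scale (\<lambda>(c, d). Poly_Mapping.single (a * c, b * d) 1) (\<Delta> l)) (\<Delta> h))"
    and comul_one: "coset (rel3 scale) (comul3 \<Delta> 1) = coset (rel3 scale)
      (t_lift free_scale (\<lambda>(a, b).
        t_lift free_scale (\<lambda>(c, d). Poly_Mapping.single (a, b * c, d) 1) (\<Delta> 1)) (\<Delta> 1))"
    and comul_one': "coset (rel3 scale) (comul3 \<Delta> 1) = coset (rel3 scale)
      (t_lift free_scale (\<lambda>(a, b).
        t_lift free_scale (\<lambda>(c, d). Poly_Mapping.single (a, c * b, d) 1) (\<Delta> 1)) (\<Delta> 1))"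
    and counit_mult: "\<epsilon> (h * m * l) = t_lift (*) (\<lambda>(a, b). \<epsilon> (h * a) * \<epsilon> (b * l)) (\<Delta> m)"
    and counit_mult': "\<epsilon> (h * m * l) = t_lift (*) (\<lambda>(a, b). \<epsilon> (h * b) * \<epsilon> (a * l)) (\<Delta> m)"

definition eps_t ::
    "('k::comm_ring_1 \<Rightarrow> 'h \<Rightarrow> 'h::{ring, monoid_mult}) \<Rightarrow> ('h \<Rightarrow> ('h \<times> 'h \<Rightarrow>\<^sub>0 'k) set) \<Rightarrow>
     ('h \<Rightarrow> 'k) \<Rightarrow> 'h \<Rightarrow> 'h" where
  "eps_t scale \<Delta> \<epsilon> h = t_lift scale (\<lambda>(a, b). scale (\<epsilon> (a * h)) b) (\<Delta> 1)"

definition eps_s ::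
    "('k::comm_ring_1 \<Rightarrow> 'h \<Rightarrow> 'h::{ring, monoid_mult}) \<Rightarrow> ('h \<Rightarrow> ('h \<times> 'h \<Rightarrow>\<^sub>0 'k) set) \<Rightarrow>
     ('h \<Rightarrow> 'k) \<Rightarrow> 'h \<Rightarrow> 'h" where
  "eps_s scale \<Delta> \<epsilon> h = t_lift scale (\<lambda>(a, b). scale (\<epsilon> (h * b)) a) (\<Delta> 1)"

definition target_space ::
    "('k::comm_ring_1 \<Rightarrow> 'h \<Rightarrow> 'h::{ring, monoid_mult}) \<Rightarrow> ('h \<Rightarrow> ('h \<times> 'h \<Rightarrow>\<^sub>0 'k) set) \<Rightarrow>
     ('h \<Rightarrow> 'k) \<Rightarrow> 'h set" where
  "target_space scale \<Delta> \<epsilon> = range (eps_t scale \<Delta> \<epsilon>)"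

definition source_space ::
    "('k::comm_ring_1 \<Rightarrow> 'h \<Rightarrow> 'h::{ring, monoid_mult}) \<Rightarrow> ('h \<Rightarrow> ('h \<times> 'h \<Rightarrow>\<^sub>0 'k) set) \<Rightarrow>
     ('h \<Rightarrow> 'k) \<Rightarrow> 'h set" where
  "source_space scale \<Delta> \<epsilon> = range (eps_s scale \<Delta> \<epsilon>)"

locale weak_hopf_algebra = weak_bialgebra scale \<Delta> \<epsilon>
  for scale :: "'k::comm_ring_1 \<Rightarrow> 'h \<Rightarrow> 'h::{ring, monoid_mult}"
    and \<Delta> :: "'h \<Rightarrow> ('h \<times> 'h \<Rightarrow>\<^sub>0 'k) set"
    and \<epsilon> :: "'h \<Rightarrow> 'k" +
  fixes S :: "'h \<Rightarrow> 'h"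
  assumes antipode_linear: "module_hom scale scale S"
    and antipode_left: "t_lift scale (\<lambda>(a, b). S a * b) (\<Delta> h) = eps_s scale \<Delta> \<epsilon> h"
    and antipode_right: "t_lift scale (\<lambda>(a, b). a * S b) (\<Delta> h) = eps_t scale \<Delta> \<epsilon> h"
    and antipode_mid: "lin_ext scale (\<lambda>(a, b, c). S a * b * S c) (comul3 \<Delta> h) = S h"


section \<open>The dual and the algebra \<open>H \<bowtie> H\<^sup>*\<close>\<close>

definition dual :: "('k::comm_ring_1 \<Rightarrow> 'h \<Rightarrow> 'h::ab_group_add) \<Rightarrow> ('h \<Rightarrow> 'k) set" where
  "dual scale = {f. module_hom scale (*) f}"

definition dual_scale :: "'k::comm_ring_1 \<Rightarrow> ('h \<Rightarrow> 'k) \<Rightarrow> ('h \<Rightarrow> 'k)" where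
  "dual_scale c f = (\<lambda>h. c * f h)"

definition conv ::
    "('h \<Rightarrow> ('h \<times> 'h \<Rightarrow>\<^sub>0 'k::comm_ring_1) set) \<Rightarrow> ('h \<Rightarrow> 'k) \<Rightarrow> ('h \<Rightarrow> 'k) \<Rightarrow> ('h \<Rightarrow> 'k)" where
  "conv \<Delta> f g = (\<lambda>h. t_lift (*) (\<lambda>(a, b). f a * g b) (\<Delta> h))"

text \<open>\<open>h \<rightharpoonup> f\<close> and \<open>f \<leftharpoonup> h\<close>.\<close>

definition left_act :: "'h::times \<Rightarrow> ('h \<Rightarrow> 'k) \<Rightarrow> ('h \<Rightarrow> 'k)" where
  "left_act h f = (\<lambda>l. f (l * h))"

definition right_act :: "('h \<Rightarrow> 'k) \<Rightarrow> 'h::times \<Rightarrow> ('h \<Rightarrow> 'k)" where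
  "right_act f h = (\<lambda>l. f (h * l))"

definition double_rel ::
    "('k::comm_ring_1 \<Rightarrow> 'h \<Rightarrow> 'h::ab_group_add) \<Rightarrow> ('h \<times> ('h \<Rightarrow> 'k) \<Rightarrow>\<^sub>0 'k) set" where
  "double_rel scale = rel2 scale UNIV dual_scale (dual scale)"

definition double_carrier ::
    "('k::comm_ring_1 \<Rightarrow> 'h \<Rightarrow> 'h::ab_group_add) \<Rightarrow> ('h \<times> ('h \<Rightarrow> 'k) \<Rightarrow>\<^sub>0 'k) set set" where
  "double_carrier scale = tensor2 scale UNIV dual_scale (dual scale)"

definition bowtie ::
    "('k::comm_ring_1 \<Rightarrow> 'h \<Rightarrow> 'h::ab_group_add) \<Rightarrow> 'h \<Rightarrow> ('h \<Rightarrow> 'k) \<Rightarrow>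
     ('h \<times> ('h \<Rightarrow> 'k) \<Rightarrow>\<^sub>0 'k) set" where
  "bowtie scale h f = coset (double_rel scale) (Poly_Mapping.single (h, f) 1)"

definition double_mult ::
    "('k::comm_ring_1 \<Rightarrow> 'h \<Rightarrow> 'h::{ring, monoid_mult}) \<Rightarrow> ('h \<Rightarrow> ('h \<times> 'h \<Rightarrow>\<^sub>0 'k) set) \<Rightarrow>
     ('h \<Rightarrow> 'h) \<Rightarrow> ('h \<times> ('h \<Rightarrow> 'k) \<Rightarrow>\<^sub>0 'k) set \<Rightarrow> ('h \<times> ('h \<Rightarrow> 'k) \<Rightarrow>\<^sub>0 'k) set \<Rightarrow>
     ('h \<times> ('h \<Rightarrow> 'k) \<Rightarrow>\<^sub>0 'k) set" where
  "double_mult scale \<Delta> S X Y = coset (double_rel scale)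
     (t_lift free_scale (\<lambda>(h, f). t_lift free_scale (\<lambda>(l, g).
        lin_ext free_scale (\<lambda>(l1, l2, l3).
          Poly_Mapping.single
            (h * l2, conv \<Delta> (right_act (left_act (inv S l1) f) l3) g) 1)
        (comul3 \<Delta> l)) Y) X)"

definition double_proj ::
    "('k::comm_ring_1 \<Rightarrow> 'h \<Rightarrow> 'h::{ring, monoid_mult}) \<Rightarrow> ('h \<Rightarrow> ('h \<times> 'h \<Rightarrow>\<^sub>0 'k) set) \<Rightarrow>
     ('h \<Rightarrow> 'k) \<Rightarrow> ('h \<Rightarrow> 'h) \<Rightarrow> ('h \<times> ('h \<Rightarrow> 'k) \<Rightarrow>\<^sub>0 'k) set \<Rightarrow> ('h \<times> ('h \<Rightarrow> 'k) \<Rightarrow>\<^sub>0 'k) set" where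
  "double_proj scale \<Delta> \<epsilon> S X = double_mult scale \<Delta> S (bowtie scale 1 \<epsilon>) X"

definition double_ker ::
    "('k::comm_ring_1 \<Rightarrow> 'h \<Rightarrow> 'h::{ring, monoid_mult}) \<Rightarrow> ('h \<Rightarrow> ('h \<times> 'h \<Rightarrow>\<^sub>0 'k) set) \<Rightarrow>
     ('h \<Rightarrow> 'k) \<Rightarrow> ('h \<Rightarrow> 'h) \<Rightarrow> ('h \<times> ('h \<Rightarrow> 'k) \<Rightarrow>\<^sub>0 'k) set set" where
  "double_ker scale \<Delta> \<epsilon> S =
     {X \<in> double_carrier scale. double_proj scale \<Delta> \<epsilon> S X = coset (double_rel scale) 0}"

end

theory Submission
  imports Defs
begin

text \<open>
  The map \<open>T h = \<epsilon> (h 1\<^sub>1) 1\<^sub>2\<close> takes values in \<open>H\<^sub>t\<close> and satisfies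
  \<open>\<epsilon> (x (S\<^sup>-\<^sup>1 h)) = \<epsilon> (x (T h))\<close>, \<open>T (h z) = T h z\<close> for \<open>z \<in> H\<^sub>t\<close> and \<open>l\<^sub>2 T l\<^sub>1 = l\<close>; likewise
  \<open>l\<^sub>1 \<epsilon>\<^sub>s l\<^sub>2 = l\<close>. Hence \<open>p (l \<bowtie> g) = l\<^sub>2 \<bowtie> (T l\<^sub>1 \<rightharpoonup> \<epsilon>) * (\<epsilon> \<leftharpoonup> \<epsilon>\<^sub>s l\<^sub>3) * g\<close>, and the two
  families of relations move \<open>T l\<^sub>1\<close> and \<open>\<epsilon>\<^sub>s l\<^sub>3\<close> back to the left factor, turning this into
  \<open>l\<^sub>2 T l\<^sub>1 \<epsilon>\<^sub>s l\<^sub>3 \<bowtie> g = l \<bowtie> g\<close>. So \<open>x - p x\<close> always lies in the span of the relations, which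
  therefore contains the kernel. Conversely \<open>p\<close> kills the relations because
  \<open>\<Delta> (h z) = h\<^sub>1 z \<otimes> h\<^sub>2\<close> and \<open>\<Delta> (h y) = h\<^sub>1 \<otimes> h\<^sub>2 y\<close>. The antipode enters only through
  \<open>\<epsilon> (S h x) = \<epsilon> (\<epsilon>\<^sub>t h x)\<close>.
\<close>

section \<open>Linear maps modulo a submodule\<close>

text \<open>Maps into a free module are multilinear only up to the tensor relations, hence linearity
  modulo \<open>N\<close>; \<open>N = {0}\<close> gives the ordinary notion. The carrier
  \<open>A\<close> accommodates the dual, which is a set of functions and not a type.\<close>

definition lin_mod ::
    "('k::comm_ring_1 \<Rightarrow> 'a \<Rightarrow> 'a::ab_group_add) \<Rightarrow> 'a set \<Rightarrow>
     ('k \<Rightarrow> 'v \<Rightarrow> 'v::ab_group_add) \<Rightarrow> 'v set \<Rightarrow> ('a \<Rightarrow> 'v) \<Rightarrow> bool" where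
  "lin_mod sA A s N f \<longleftrightarrow>
     (\<forall>a\<in>A. \<forall>a'\<in>A. f (a + a') - (f a + f a') \<in> N) \<and> (\<forall>c. \<forall>a\<in>A. f (sA c a) - s c (f a) \<in> N)"

text \<open>Congruence modulo \<open>N\<close> stands in for a quotient: one calculus then serves
  both for equations in H and k and for congruences between free representatives.\<close>

locale module_mod = module s
  for s :: "'k::comm_ring_1 \<Rightarrow> 'v \<Rightarrow> 'v::ab_group_add" +
  fixes N :: "'v set"
  assumes subspace_N: "subspace N"
begin

definition eqv (infix "\<approx>" 50) where "x \<approx> y \<longleftrightarrow> x - y \<in> N"

lemma eqv_refl [simp, intro]: "x \<approx> x"
  using subspace_N by (simp add: eqv_def subspace_0)

lemma eqv_sym: "x \<approx> y \<Longrightarrow> y \<approx> x"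
  using subspace_neg[OF subspace_N, of "x - y"] by (simp add: eqv_def)

lemma eqv_trans [trans]: "x \<approx> y \<Longrightarrow> y \<approx> z \<Longrightarrow> x \<approx> z"
  using subspace_add[OF subspace_N, of "x - y" "y - z"] by (simp add: eqv_def)

lemma eqv_add: "x \<approx> x' \<Longrightarrow> y \<approx> y' \<Longrightarrow> x + y \<approx> x' + y'"
  using subspace_add[OF subspace_N, of "x - x'" "y - y'"] by (simp add: eqv_def algebra_simps)

lemma eqv_scale: "x \<approx> y \<Longrightarrow> s c x \<approx> s c y"
  using subspace_scale[OF subspace_N, of "x - y" c] by (simp add: eqv_def scale_right_diff_distrib)

lemma eqv_sum: "(\<And>i. i \<in> I \<Longrightarrow> f i \<approx> g i) \<Longrightarrow> sum f I \<approx> sum g I"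
  unfolding eqv_def sum_subtractf[symmetric] by (rule subspace_sum[OF subspace_N])

lemma lin_modI:
  assumes "\<And>a a'. a \<in> A \<Longrightarrow> a' \<in> A \<Longrightarrow> f (a + a') \<approx> f a + f a'"
    and "\<And>c a. a \<in> A \<Longrightarrow> f (sA c a) \<approx> s c (f a)"
  shows "lin_mod sA A s N f"
  using assms by (simp add: lin_mod_def eqv_def)

lemma lin_mod_add: "lin_mod sA A s N f \<Longrightarrow> a \<in> A \<Longrightarrow> a' \<in> A \<Longrightarrow> f (a + a') \<approx> f a + f a'"
  by (simp add: lin_mod_def eqv_def)

lemma lin_mod_scale: "lin_mod sA A s N f \<Longrightarrow> a \<in> A \<Longrightarrow> f (sA c a) \<approx> s c (f a)"
  by (simp add: lin_mod_def eqv_def)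

lemma lin_ext_eqv:
  assumes "\<And>g. g \<in> Poly_Mapping.keys x \<Longrightarrow> f g \<approx> f' g"
  shows "lin_ext s f x \<approx> lin_ext s f' x"
  unfolding lin_ext_def by (intro eqv_sum eqv_scale assms)

lemma lin_mod_lin_ext:
  assumes "\<And>g. g \<in> Poly_Mapping.keys x \<Longrightarrow> lin_mod sA A s N (\<lambda>a. f a g)"
  shows "lin_mod sA A s N (\<lambda>a. lin_ext s (f a) x)"
proof (rule lin_modI)
  fix a a' assume "a \<in> A" "a' \<in> A"
  then have "lin_ext s (f (a + a')) x \<approx> lin_ext s (\<lambda>g. f a g + f a' g) x"
    by (intro lin_ext_eqv) (rule lin_mod_add[OF assms])
  then show "lin_ext s (f (a + a')) x \<approx> lin_ext s (f a) x + lin_ext s (f a') x"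
    by (simp add: lin_ext_def scale_right_distrib sum.distrib)
next
  fix c a assume "a \<in> A"
  then have "lin_ext s (f (sA c a)) x \<approx> lin_ext s (\<lambda>g. s c (f a g)) x"
    by (intro lin_ext_eqv) (rule lin_mod_scale[OF assms])
  then show "lin_ext s (f (sA c a)) x \<approx> s c (lin_ext s (f a) x)"
    by (simp add: lin_ext_def scale_sum_right mult.commute)
qed

text \<open>Each summand costs one use of additivity and one of homogeneity, and these errors stay
  in \<open>N\<close>. The empty sum needs \<open>f 0 \<approx> 0\<close>, which is homogeneity for
  the scalar 0.\<close>

lemma lin_mod_apply_lin_ext:
  assumes f: "lin_mod sA UNIV s N f" and sA: "module sA"
  shows "f (lin_ext sA g x) \<approx> lin_ext s (\<lambda>i. f (g i)) x"
proof -
  interpret A: module sA by fact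
  have zero: "f 0 \<approx> 0"
    using lin_mod_scale[OF f UNIV_I, of 0 0] by simp
  have "f (\<Sum>i\<in>I. sA (c i) (g i)) \<approx> (\<Sum>i\<in>I. s (c i) (f (g i)))" if "finite I" for I and c :: "_ \<Rightarrow> _"
    using that
  proof induction
    case empty
    then show ?case using zero by simp
  next
    case (insert i I)
    have "f (\<Sum>i\<in>insert i I. sA (c i) (g i)) \<approx> f (sA (c i) (g i)) + f (\<Sum>i\<in>I. sA (c i) (g i))"
      using insert lin_mod_add[OF f] by simp
    also have "\<dots> \<approx> s (c i) (f (g i)) + (\<Sum>i\<in>I. s (c i) (f (g i)))"
      by (intro eqv_add lin_mod_scale[OF f] insert UNIV_I)
    finally show ?case using insert by simp
  qed
  then show ?thesis by (simp add: lin_ext_def)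
qed

lemma lin_ext_span_in:
  assumes "x \<in> free_module.span G" and "\<And>g. g \<in> G \<Longrightarrow> lin_ext s f g \<in> N"
  shows "lin_ext s f x \<in> N"
proof -
  interpret h: module_hom free_scale s "lin_ext s f"
    by (rule lin_ext_linear) unfold_locales
  show ?thesis
    using assms(1)
  proof (induction rule: free_module.span_induct)
    case base
    show ?case
      using subspace_N by (auto simp: free_module.subspace_def subspace_def h.zero h.add h.scale)
  qed (use assms(2) in auto)
qed

lemma lin_ext_linear_rels:
  assumes "lin_mod sA A s N (\<lambda>a. f (ins a))" "r \<in> linear_rels sA A ins"
  shows "lin_ext s f r \<in> N"
proof -
  have m: "module s" by unfold_locales
  interpret h: module_hom free_scale s "lin_ext s f"
    by (rule lin_ext_linear[OF m])
  show ?thesis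
    using assms by (auto simp: linear_rels_def lin_mod_def h.diff h.add h.scale m)
qed

text \<open>The linear extension sends every generating relation into \<open>N\<close>, hence also
  their span. This is the independence of the representative from \<open>t_lift_coset\<close>, for
  maps that are bilinear only up to \<open>N\<close>.\<close>

lemma lin_ext_rel2:
  assumes "\<And>b. b \<in> B \<Longrightarrow> lin_mod sA A s N (\<lambda>a. f (a, b))"
    and "\<And>a. a \<in> A \<Longrightarrow> lin_mod sB B s N (\<lambda>b. f (a, b))"
    and "x - y \<in> rel2 sA A sB B"
  shows "lin_ext s f x \<approx> lin_ext s f y"
proof -
  interpret h: module_hom free_scale s "lin_ext s f"
    by (rule lin_ext_linear) unfold_locales
  have "lin_ext s f (x - y) \<in> N"
    using assms(3) unfolding rel2_def
    by (rule lin_ext_span_in) (auto intro: lin_ext_linear_rels assms(1,2))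
  then show ?thesis by (simp add: eqv_def h.diff)
qed

lemma lin_ext_rel3:
  assumes "\<And>b c. lin_mod sA UNIV s N (\<lambda>a. f (a, b, c))"
    and "\<And>a c. lin_mod sA UNIV s N (\<lambda>b. f (a, b, c))"
    and "\<And>a b. lin_mod sA UNIV s N (\<lambda>c. f (a, b, c))"
    and "x - y \<in> rel3 sA"
  shows "lin_ext s f x \<approx> lin_ext s f y"
proof -
  interpret h: module_hom free_scale s "lin_ext s f"
    by (rule lin_ext_linear) unfold_locales
  have "lin_ext s f (x - y) \<in> N"
    using assms(4) unfolding rel3_def
    by (rule lin_ext_span_in) (auto intro: lin_ext_linear_rels assms(1-3))
  then show ?thesis by (simp add: eqv_def h.diff)
qed

end

lemma lin_mod_zero_iff:
  "lin_mod sA UNIV s {0} f \<longleftrightarrow> (\<forall>a a'. f (a + a') = f a + f a') \<and> (\<forall>c a. f (sA c a) = s c (f a))"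
  by (simp add: lin_mod_def)

lemma module_mod_zero: "module s \<Longrightarrow> module_mod s {0}"
  by (simp add: module_mod_def module_mod_axioms_def module.subspace_single_0)

lemma module_hom_lin_ext:
  assumes "module_hom s s' f"
  shows "f (lin_ext s g x) = lin_ext s' (\<lambda>i. f (g i)) x"
proof -
  interpret module_hom s s' f by fact
  show ?thesis by (simp add: lin_ext_def sum scale)
qed

lemma lin_ext_lin_ext:
  assumes "module s"
  shows "lin_ext s f (lin_ext free_scale g x) = lin_ext s (\<lambda>i. lin_ext s f (g i)) x"
  by (rule module_hom_lin_ext[OF lin_ext_linear[OF assms]])

lemma lin_ext_commute:
  assumes "module s"
  shows "lin_ext s (\<lambda>i. lin_ext s (f i) y) x = lin_ext s (\<lambda>j. lin_ext s (\<lambda>i. f i j) x) y"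
proof -
  interpret module s by fact
  show ?thesis
    unfolding lin_ext_def scale_sum_right by (subst sum.swap) (simp add: mult.commute)
qed

section \<open>Cosets\<close>

locale free_submodule =
  fixes R :: "('g \<Rightarrow>\<^sub>0 'k::comm_ring_1) set"
  assumes subspace_R: "free_module.subspace R"
begin

lemma coset_eq_iff: "coset R x = coset R y \<longleftrightarrow> x - y \<in> R"
proof
  assume "coset R x = coset R y"
  then show "x - y \<in> R"
    using free_module.subspace_0[OF subspace_R] by (auto simp: coset_def)
next
  assume xy: "x - y \<in> R"
  have "z - x \<in> R \<longleftrightarrow> z - y \<in> R" for z
    using free_module.subspace_add[OF subspace_R _ xy, of "z - x"]
      free_module.subspace_diff[OF subspace_R _ xy, of "z - y"] by auto
  then show "coset R x = coset R y" by (auto simp: coset_def)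
qed

lemma self_in_coset: "x \<in> coset R x"
  using free_module.subspace_0[OF subspace_R] by (simp add: coset_def)

lemma rep_coset: "rep (coset R x) - x \<in> R"
  using someI[of "\<lambda>y. y \<in> coset R x", OF self_in_coset] by (simp add: rep_def coset_def)

lemma q_add_coset: "q_add R (coset R x) (coset R y) = coset R (x + y)"
proof safe
  fix z assume "z \<in> q_add R (coset R x) (coset R y)"
  then obtain u v where "u - x \<in> R" "v - y \<in> R" "z - (u + v) \<in> R"
    by (auto simp: q_add_def coset_def)
  then have "(z - (u + v)) + ((u - x) + (v - y)) \<in> R"
    by (intro free_module.subspace_add[OF subspace_R])
  then show "z \<in> coset R (x + y)" by (simp add: coset_def algebra_simps)
next
  fix z assume "z \<in> coset R (x + y)"
  then show "z \<in> q_add R (coset R x) (coset R y)"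
    unfolding q_add_def coset_def[of R "x + y"] using self_in_coset by blast
qed

lemma q_diff_coset: "q_diff R (coset R x) (coset R y) = coset R (x - y)"
proof safe
  fix z assume "z \<in> q_diff R (coset R x) (coset R y)"
  then obtain u v where uv: "u - x \<in> R" "v - y \<in> R" "z - (u - v) \<in> R"
    by (auto simp: q_diff_def coset_def)
  have "(z - (u - v)) + ((u - x) - (v - y)) \<in> R"
    by (rule free_module.subspace_add[OF subspace_R uv(3)
          free_module.subspace_diff[OF subspace_R uv(1,2)]])
  then show "z \<in> coset R (x - y)" by (simp add: coset_def algebra_simps)
next
  fix z assume "z \<in> coset R (x - y)"
  then show "z \<in> q_diff R (coset R x) (coset R y)"
    unfolding q_diff_def coset_def[of R "x - y"] using self_in_coset by blast
qed

lemma q_scale_coset: "q_scale R c (coset R x) = coset R (free_scale c x)"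
proof safe
  fix z assume "z \<in> q_scale R c (coset R x)"
  then obtain u where "u - x \<in> R" "z - free_scale c u \<in> R"
    by (auto simp: q_scale_def coset_def)
  then have "(z - free_scale c u) + free_scale c (u - x) \<in> R"
    by (intro free_module.subspace_add[OF subspace_R] free_module.subspace_scale[OF subspace_R])
  then show "z \<in> coset R (free_scale c x)"
    by (simp add: coset_def free_module.scale_right_diff_distrib)
next
  fix z assume "z \<in> coset R (free_scale c x)"
  then show "z \<in> q_scale R c (coset R x)"
    unfolding q_scale_def coset_def[of R "free_scale c x"] using self_in_coset by blast
qed

text \<open>Reduces spans of cosets to spans in the free module. Elements of \<open>R\<close> have
  the zero coset, so adding them to the generators does not enlarge the image, and it makes the span
  on the right closed under change of representative.\<close>

lemma q_span_cosets:
  "q_span R (coset R ` G) = coset R ` free_module.span (R \<union> G)"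
proof safe
  fix X assume "X \<in> q_span R (coset R ` G)"
  then show "X \<in> coset R ` free_module.span (R \<union> G)"
  proof induction
    case (q_span_add X Y)
    then show ?case by (auto simp: q_add_coset intro!: imageI free_module.span_add)
  next
    case (q_span_scale X c)
    then show ?case by (auto simp: q_scale_coset intro!: imageI free_module.span_scale)
  qed (auto intro: free_module.span_base free_module.span_zero)
next
  fix x assume "x \<in> free_module.span (R \<union> G)"
  then show "coset R x \<in> q_span R (coset R ` G)"
  proof (induction rule: free_module.span_induct)
    case base
    show ?case
    proof (rule free_module.subspaceI)
      fix x y c
      assume "x \<in> {x. coset R x \<in> q_span R (coset R ` G)}"
      then show "free_scale c x \<in> {x. coset R x \<in> q_span R (coset R ` G)}"
        by (simp add: q_span_scale flip: q_scale_coset)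
      assume "y \<in> {x. coset R x \<in> q_span R (coset R ` G)}"
      with \<open>x \<in> _\<close> show "x + y \<in> {x. coset R x \<in> q_span R (coset R ` G)}"
        by (simp add: q_span_add flip: q_add_coset)
    qed (simp add: q_span_zero)
  next
    case (step x)
    show ?case
    proof (cases "x \<in> G")
      case False
      with step have "coset R x = coset R 0" by (simp add: coset_eq_iff)
      then show ?thesis by (simp add: q_span_zero)
    qed (auto intro: q_span_base)
  qed
qed

end

lemma free_submodule_rel2: "free_submodule (rel2 sA A sB B)"
  by unfold_locales (simp add: rel2_def free_module.subspace_span)

lemma free_submodule_rel3: "free_submodule (rel3 s)"
  by unfold_locales (simp add: rel3_def free_module.subspace_span)

section \<open>Sweedler sums\<close>

context weak_bialgebra
begin

text \<open>Evaluation at one fixed representative of \<open>\<Delta> h\<close>. Pushing linear maps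
  inside and interchanging sums are therefore valid for arbitrary \<open>f\<close>, bilinear or
  not.\<close>

definition sw :: "('k \<Rightarrow> 'v \<Rightarrow> 'v::ab_group_add) \<Rightarrow> ('h \<Rightarrow> 'h \<Rightarrow> 'v) \<Rightarrow> 'h \<Rightarrow> 'v" where
  "sw s f h = lin_ext s (\<lambda>(a, b). f a b) (rep (\<Delta> h))"

definition bilin :: "('k \<Rightarrow> 'v \<Rightarrow> 'v::ab_group_add) \<Rightarrow> 'v set \<Rightarrow> ('h \<Rightarrow> 'h \<Rightarrow> 'v) \<Rightarrow> bool" where
  "bilin s N f \<longleftrightarrow>
     (\<forall>b. lin_mod scale UNIV s N (\<lambda>a. f a b)) \<and> (\<forall>a. lin_mod scale UNIV s N (f a))"

definition trilin :: "('k \<Rightarrow> 'v \<Rightarrow> 'v::ab_group_add) \<Rightarrow> 'v set \<Rightarrow> ('h \<Rightarrow> 'h \<Rightarrow> 'h \<Rightarrow> 'v) \<Rightarrow> bool"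
  where
  "trilin s N f \<longleftrightarrow>
     (\<forall>b c. lin_mod scale UNIV s N (\<lambda>a. f a b c)) \<and> (\<forall>a. bilin s N (f a))"

lemma counit_hom_right: "module_hom scale (*) (\<lambda>a. \<epsilon> (a * h))"
proof -
  interpret e: module_hom scale "(*)" \<epsilon> by (rule counit_linear)
  show ?thesis
    by unfold_locales (simp_all add: distrib_right e.add e.scale flip: scale_mult_left)
qed

lemma counit_hom_left: "module_hom scale (*) (\<lambda>a. \<epsilon> (h * a))"
proof -
  interpret e: module_hom scale "(*)" \<epsilon> by (rule counit_linear)
  show ?thesis
    by unfold_locales (simp_all add: distrib_left e.add e.scale flip: scale_mult_right)
qed

lemma t_lift_sw: "t_lift s (\<lambda>(a, b). f a b) (\<Delta> h) = sw s f h"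
  by (simp add: t_lift_def sw_def)

lemma module_hom_sw: "module_hom s s' g \<Longrightarrow> g (sw s f h) = sw s' (\<lambda>a b. g (f a b)) h"
  by (simp add: sw_def module_hom_lin_ext case_prod_unfold)

lemma sw_commute:
  "module s \<Longrightarrow> sw s (\<lambda>a b. sw s (f a b) l) h = sw s (\<lambda>c d. sw s (\<lambda>a b. f a b c d) h) l"
  unfolding sw_def
  using lin_ext_commute[of s "\<lambda>x y. case x of (a, b) \<Rightarrow> case y of (c, d) \<Rightarrow> f a b c d"
      "rep (\<Delta> l)" "rep (\<Delta> h)"]
  by (simp add: case_prod_unfold)

lemma lin_ext_t_lift:
  "module s \<Longrightarrow> lin_ext s g (t_lift free_scale (\<lambda>(a, b). f a b) (\<Delta> h))
     = sw s (\<lambda>a b. lin_ext s g (f a b)) h"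
  by (simp add: t_lift_def sw_def lin_ext_lin_ext case_prod_unfold)

text \<open>The bracketing of \<open>comul3\<close>: the left leg is split again.\<close>

definition sw3 :: "('k \<Rightarrow> 'v \<Rightarrow> 'v::ab_group_add) \<Rightarrow> ('h \<Rightarrow> 'h \<Rightarrow> 'h \<Rightarrow> 'v) \<Rightarrow> 'h \<Rightarrow> 'v" where
  "sw3 s f h = sw s (\<lambda>a c. sw s (\<lambda>a b. f a b c) a) h"

lemma lin_ext_comul3:
  assumes "module s"
  shows "lin_ext s (\<lambda>(a, b, c). f a b c) (comul3 \<Delta> h) = sw3 s f h"
proof -
  interpret M: module s by fact
  show ?thesis
    by (simp add: comul3_def sw3_def lin_ext_t_lift assms)
qed

lemma lin_ext_comul3':
  assumes "module s"
  shows "lin_ext s (\<lambda>(a, b, c). f a b c) (comul3' \<Delta> h) = sw s (\<lambda>a b. sw s (f a) b) h"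
proof -
  interpret M: module s by fact
  show ?thesis
    by (simp add: comul3'_def lin_ext_t_lift assms)
qed

lemma module_scale: "module scale"
  by unfold_locales

sublocale H: free_submodule "relH scale"
  by (rule free_submodule_rel2)

sublocale H3: free_submodule "rel3 scale"
  by (rule free_submodule_rel3)

lemma comul_rep: "\<Delta> h = coset (relH scale) (rep (\<Delta> h))"
proof -
  obtain x where "\<Delta> h = coset (relH scale) x"
    using comul_tensor[of h] by (auto simp: tensor2_def)
  then show ?thesis
    using H.rep_coset[of x] by (simp add: H.coset_eq_iff)
      (metis H.coset_eq_iff)
qed

lemma rep_comul:
  assumes "\<Delta> h = coset (relH scale) x"
  shows "rep (\<Delta> h) - x \<in> relH scale"
  using assms H.rep_coset by simp

end

section \<open>Sweedler calculus modulo a submodule\<close>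

locale weak_bialgebra_mod = weak_bialgebra scale \<Delta> \<epsilon> + M: module_mod s N
  for scale :: "'k::comm_ring_1 \<Rightarrow> 'h \<Rightarrow> 'h::{ring, monoid_mult}" and \<Delta> \<epsilon>
    and s :: "'k \<Rightarrow> 'v \<Rightarrow> 'v::ab_group_add" and N
begin

notation M.eqv (infix "\<approx>" 50)

lemma module_s: "module s"
  by unfold_locales

lemma sw_eqv: "(\<And>a b. f a b \<approx> g a b) \<Longrightarrow> sw s f h \<approx> sw s g h"
  unfolding sw_def by (rule M.lin_ext_eqv) auto

text \<open>Any representative may replace the chosen one when \<open>f\<close> is bilinear modulo
  \<open>N\<close>. The axioms stated as equalities of tensors enter through this lemma or through
  \<open>trilin_rel\<close>.\<close>

lemma sw_rel:
  assumes "bilin s N f" "\<Delta> h = coset (relH scale) x"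
  shows "sw s f h \<approx> lin_ext s (\<lambda>(a, b). f a b) x"
  unfolding sw_def using assms
  by (intro M.lin_ext_rel2[where sA = scale and A = UNIV and sB = scale and B = UNIV] rep_comul) (auto simp: bilin_def)

lemma lin_mod_sw_arg:
  assumes "bilin s N f"
  shows "lin_mod scale UNIV s N (sw s f)"
proof (rule M.lin_modI)
  interpret h: module_hom free_scale s "lin_ext s (\<lambda>(a, b). f a b)"
    by (rule lin_ext_linear[OF module_s])
  fix a a' c
  have "\<Delta> (a + a') = coset (relH scale) (rep (\<Delta> a) + rep (\<Delta> a'))"
    using H.q_add_coset comul_add comul_rep by metis
  from sw_rel[OF assms this] show "sw s f (a + a') \<approx> sw s f a + sw s f a'"
    by (simp add: h.add sw_def)
  have "\<Delta> (scale c a) = coset (relH scale) (free_scale c (rep (\<Delta> a)))"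
    using H.q_scale_coset comul_scale comul_rep by metis
  from sw_rel[OF assms this] show "sw s f (scale c a) \<approx> s c (sw s f a)"
    by (simp add: h.scale sw_def)
qed

lemma lin_mod_sw:
  assumes "\<And>a b. lin_mod sA A s N (\<lambda>x. f x a b)"
  shows "lin_mod sA A s N (\<lambda>x. sw s (f x) h)"
  unfolding sw_def using M.lin_mod_lin_ext[of "rep (\<Delta> h)" sA A "\<lambda>x (a, b). f x a b"] assms
  by (simp add: case_prod_unfold)

lemma sw_apply:
  assumes "lin_mod sA UNIV s N g" "module sA"
  shows "g (sw sA f h) \<approx> sw s (\<lambda>a b. g (f a b)) h"
  unfolding sw_def using M.lin_mod_apply_lin_ext[OF assms] by (simp add: case_prod_unfold)

lemma sw_mult:
  assumes "bilin s N f"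
  shows "sw s f (h * l) \<approx> sw s (\<lambda>a b. sw s (\<lambda>c d. f (a * c) (b * d)) l) h"
  using sw_rel[OF assms comul_mult] by (simp add: lin_ext_t_lift module_s)

lemma trilin_rel:
  assumes "trilin s N f" "coset (rel3 scale) x = coset (rel3 scale) y"
  shows "lin_ext s (\<lambda>(a, b, c). f a b c) x \<approx> lin_ext s (\<lambda>(a, b, c). f a b c) y"
  using assms by (intro M.lin_ext_rel3[of scale]) (auto simp: trilin_def bilin_def H3.coset_eq_iff)

lemma sw_coassoc: "trilin s N f \<Longrightarrow> sw3 s f h \<approx> sw s (\<lambda>a b. sw s (f a) b) h"
  using trilin_rel[OF _ coassoc] by (simp add: lin_ext_comul3 lin_ext_comul3' module_s)

lemma sw_one: "trilin s N f \<Longrightarrow> sw3 s f 1 \<approx> sw s (\<lambda>a b. sw s (\<lambda>c d. f a (b * c) d) 1) 1"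
  using trilin_rel[OF _ comul_one] by (simp add: lin_ext_comul3 lin_ext_t_lift module_s)

lemma sw_one': "trilin s N f \<Longrightarrow> sw3 s f 1 \<approx> sw s (\<lambda>a b. sw s (\<lambda>c d. f a (c * b) d) 1) 1"
  using trilin_rel[OF _ comul_one'] by (simp add: lin_ext_comul3 lin_ext_t_lift module_s)

lemma lin_mod_sw3:
  assumes "trilin s N f"
  shows "lin_mod scale UNIV s N (sw3 s f)"
  unfolding sw3_def using assms
  by (intro lin_mod_sw_arg) (auto simp: bilin_def trilin_def intro!: lin_mod_sw lin_mod_sw_arg)

lemma lin_mod_coeff:
  assumes "module_hom sA (*) g"
  shows "lin_mod sA A s N (\<lambda>a. s (g a) v)"
proof -
  interpret g: module_hom sA "(*)" g by fact
  show ?thesis by (rule M.lin_modI) (simp_all add: g.add g.scale M.scale_left_distrib)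
qed

lemma lin_mod_scaled:
  assumes "lin_mod sA A s N f"
  shows "lin_mod sA A s N (\<lambda>a. s c (f a))"
proof (rule M.lin_modI)
  fix a a' assume "a \<in> A" "a' \<in> A"
  then show "s c (f (a + a')) \<approx> s c (f a) + s c (f a')"
    using M.eqv_scale[OF M.lin_mod_add[OF assms]] by (simp add: M.scale_right_distrib)
next
  fix d a assume "a \<in> A"
  then show "s c (f (sA d a)) \<approx> s d (s c (f a))"
    using M.eqv_scale[OF M.lin_mod_scale[OF assms], of a c d] by (simp add: mult.commute)
qed

lemma lin_mod_comp_left:
  "lin_mod scale UNIV s N f \<Longrightarrow> lin_mod scale UNIV s N (\<lambda>a. f (c * a))"
  by (simp add: lin_mod_def distrib_left flip: scale_mult_right)

lemma lin_mod_comp_right: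
  "lin_mod scale UNIV s N f \<Longrightarrow> lin_mod scale UNIV s N (\<lambda>a. f (a * c))"
  by (simp add: lin_mod_def distrib_right flip: scale_mult_left)

lemma bilinD: "bilin s N f \<Longrightarrow> lin_mod scale UNIV s N (\<lambda>a. f a b)" "bilin s N f \<Longrightarrow> lin_mod scale UNIV s N (f a)"
  by (simp_all add: bilin_def)

lemmas lin_mod_intros = lin_mod_coeff lin_mod_scaled

lemma sw_apply_coeff:
  assumes "lin_mod scale UNIV s N g"
  shows "g (sw scale (\<lambda>a b. scale (c a b) (f a b)) h) \<approx> sw s (\<lambda>a b. s (c a b) (g (f a b))) h"
proof -
  have "g (sw scale (\<lambda>a b. scale (c a b) (f a b)) h) \<approx> sw s (\<lambda>a b. g (scale (c a b) (f a b))) h"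
    by (rule sw_apply[OF assms module_scale])
  also have "\<dots> \<approx> sw s (\<lambda>a b. s (c a b) (g (f a b))) h"
    by (rule sw_eqv) (rule M.lin_mod_scale[OF assms UNIV_I])
  finally show ?thesis .
qed

lemma scaled_sw: "s c (sw s f h) = sw s (\<lambda>a b. s c (f a b)) h"
  by (rule module_hom_sw) (unfold_locales, auto simp: M.scale_right_distrib mult.commute)

text \<open>Expanding \<open>z\<close> as \<open>\<epsilon> (1\<^sub>1 h) 1\<^sub>2\<close>,
  coassociativity expresses \<open>\<Delta> z\<close> through the iterated coproduct of 1. The two
  factorizations of the latter put \<open>z\<close> on either side of the first leg: \<open>\<Delta>
  z = z 1\<^sub>1 \<otimes> 1\<^sub>2 = 1\<^sub>1 z \<otimes> 1\<^sub>2\<close>.\<close>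

lemma sw_eps_t:
  fixes h
  assumes f: "bilin s N f"
  defines "z \<equiv> eps_t scale \<Delta> \<epsilon> h"
  shows "sw s f z \<approx> sw s (\<lambda>a b. f (z * a) b) 1" "sw s f z \<approx> sw s (\<lambda>a b. f (a * z) b) 1"
proof -
  let ?g = "\<lambda>a b c. s (\<epsilon> (a * h)) (f b c)"
  have z: "z = sw scale (\<lambda>a b. scale (\<epsilon> (a * h)) b) 1"
    by (simp add: z_def eps_t_def t_lift_sw)
  have tri: "trilin s N ?g"
    using f by (auto simp: trilin_def bilin_def intro!: lin_mod_intros counit_hom_right)
  have "sw s f z \<approx> sw s (\<lambda>a b. s (\<epsilon> (a * h)) (sw s f b)) 1"
    unfolding z by (rule sw_apply_coeff[OF lin_mod_sw_arg[OF f]])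
  also have "\<dots> = sw s (\<lambda>a b. sw s (?g a) b) 1"
    by (simp add: scaled_sw)
  also have "\<dots> \<approx> sw3 s ?g 1"
    by (rule M.eqv_sym[OF sw_coassoc[OF tri]])
  finally have *: "sw s f z \<approx> sw3 s ?g 1" .
  note *
  also have "sw3 s ?g 1 \<approx> sw s (\<lambda>a b. sw s (\<lambda>c d. s (\<epsilon> (a * h)) (f (b * c) d)) 1) 1"
    by (rule sw_one[OF tri])
  \<comment> \<open>The sum over \<open>a\<close> and \<open>b\<close> has to be the inner one, so
    that it collects to \<open>z\<close>.\<close>
  also have "\<dots> = sw s (\<lambda>c d. sw s (\<lambda>a b. s (\<epsilon> (a * h)) (f (b * c) d)) 1) 1"
    by (rule sw_commute[OF module_s])
  also have "\<dots> \<approx> sw s (\<lambda>c d. f (z * c) d) 1"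
  proof (rule sw_eqv)
    fix c d
    show "sw s (\<lambda>a b. s (\<epsilon> (a * h)) (f (b * c) d)) 1 \<approx> f (z * c) d"
      unfolding z
      by (rule M.eqv_sym[OF sw_apply_coeff[of "\<lambda>x. f (x * c) d" "\<lambda>a b. \<epsilon> (a * h)" "\<lambda>a b. b"]])
        (rule lin_mod_comp_right[OF bilinD(1)[OF f]])
  qed
  finally show "sw s f z \<approx> sw s (\<lambda>a b. f (z * a) b) 1" .
  note *
  also have "sw3 s ?g 1 \<approx> sw s (\<lambda>a b. sw s (\<lambda>c d. s (\<epsilon> (a * h)) (f (c * b) d)) 1) 1"
    by (rule sw_one'[OF tri])
  also have "\<dots> = sw s (\<lambda>c d. sw s (\<lambda>a b. s (\<epsilon> (a * h)) (f (c * b) d)) 1) 1"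
    by (rule sw_commute[OF module_s])
  also have "\<dots> \<approx> sw s (\<lambda>c d. f (c * z) d) 1"
  proof (rule sw_eqv)
    fix c d
    show "sw s (\<lambda>a b. s (\<epsilon> (a * h)) (f (c * b) d)) 1 \<approx> f (c * z) d"
      unfolding z
      by (rule M.eqv_sym[OF sw_apply_coeff[of "\<lambda>x. f (c * x) d" "\<lambda>a b. \<epsilon> (a * h)" "\<lambda>a b. b"]])
        (rule lin_mod_comp_left[OF bilinD(1)[OF f]])
  qed
  finally show "sw s f z \<approx> sw s (\<lambda>a b. f (a * z) b) 1" .
qed

text \<open>Mirror image of \<open>sw_eps_t\<close>, with \<open>y\<close> on the second leg. Here
  \<open>\<Delta>\<close> splits the first leg of \<open>\<Delta> 1\<close>, which is already the
  nesting of \<open>sw3\<close>, so coassociativity does not intervene.\<close>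

lemma sw_eps_s:
  fixes h
  assumes f: "bilin s N f"
  defines "y \<equiv> eps_s scale \<Delta> \<epsilon> h"
  shows "sw s f y \<approx> sw s (\<lambda>a b. f a (b * y)) 1" "sw s f y \<approx> sw s (\<lambda>a b. f a (y * b)) 1"
proof -
  let ?g = "\<lambda>a b c. s (\<epsilon> (h * c)) (f a b)"
  have y: "y = sw scale (\<lambda>a b. scale (\<epsilon> (h * b)) a) 1"
    by (simp add: y_def eps_s_def t_lift_sw)
  have tri: "trilin s N ?g"
    using f by (auto simp: trilin_def bilin_def intro!: lin_mod_intros counit_hom_left)
  have "sw s f y \<approx> sw s (\<lambda>a b. s (\<epsilon> (h * b)) (sw s f a)) 1"
    unfolding y by (rule sw_apply_coeff[OF lin_mod_sw_arg[OF f]])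
  also have "\<dots> = sw3 s ?g 1"
    by (simp add: scaled_sw sw3_def)
  finally have *: "sw s f y \<approx> sw3 s ?g 1" .
  note *
  also have "sw3 s ?g 1 \<approx> sw s (\<lambda>a b. sw s (\<lambda>c d. s (\<epsilon> (h * d)) (f a (b * c))) 1) 1"
    by (rule sw_one[OF tri])
  also have "\<dots> \<approx> sw s (\<lambda>a b. f a (b * y)) 1"
  proof (rule sw_eqv)
    fix a b
    show "sw s (\<lambda>c d. s (\<epsilon> (h * d)) (f a (b * c))) 1 \<approx> f a (b * y)"
      unfolding y
      by (rule M.eqv_sym[OF sw_apply_coeff[of "\<lambda>x. f a (b * x)" "\<lambda>c d. \<epsilon> (h * d)" "\<lambda>c d. c"]])
        (rule lin_mod_comp_left[OF bilinD(2)[OF f]])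
  qed
  finally show "sw s f y \<approx> sw s (\<lambda>a b. f a (b * y)) 1" .
  note *
  also have "sw3 s ?g 1 \<approx> sw s (\<lambda>a b. sw s (\<lambda>c d. s (\<epsilon> (h * d)) (f a (c * b))) 1) 1"
    by (rule sw_one'[OF tri])
  also have "\<dots> \<approx> sw s (\<lambda>a b. f a (y * b)) 1"
  proof (rule sw_eqv)
    fix a b
    show "sw s (\<lambda>c d. s (\<epsilon> (h * d)) (f a (c * b))) 1 \<approx> f a (y * b)"
      unfolding y
      by (rule M.eqv_sym[OF sw_apply_coeff[of "\<lambda>x. f a (x * b)" "\<lambda>c d. \<epsilon> (h * d)" "\<lambda>c d. c"]])
        (rule lin_mod_comp_right[OF bilinD(2)[OF f]])
  qed
  finally show "sw s f y \<approx> sw s (\<lambda>a b. f a (y * b)) 1" .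
qed

lemma bilin_mult:
  assumes "bilin s N f"
  shows "bilin s N (\<lambda>a b. f (p * a * p') (q * b * q'))"
  using assms unfolding bilin_def lin_mod_def
  by (simp add: distrib_left distrib_right flip: scale_mult_left scale_mult_right)

text \<open>In \<open>\<Delta> h \<Delta> z\<close> the second factor is
  \<open>1\<^sub>1 z \<otimes> 1\<^sub>2\<close>; once \<open>z\<close> is pulled out, what remains
  is \<open>\<Delta> (h 1)\<close>.\<close>

lemma sw_mult_target:
  assumes f: "bilin s N f" and z: "z \<in> target_space scale \<Delta> \<epsilon>"
  shows "sw s f (h * z) \<approx> sw s (\<lambda>a b. f (a * z) b) h"
proof -
  have b1: "bilin s N (\<lambda>a b. f (p * a) (q * b))" for p q
    using bilin_mult[OF f, of p 1 q 1] by simp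
  have b2: "bilin s N (\<lambda>a b. f (a * z) b)"
    using bilin_mult[OF f, of 1 z 1 1] by simp
  have "sw s f (h * z) \<approx> sw s (\<lambda>a b. sw s (\<lambda>c d. f (a * c) (b * d)) z) h"
    by (rule sw_mult[OF f])
  also have "\<dots> \<approx> sw s (\<lambda>a b. sw s (\<lambda>c d. f (a * (c * z)) (b * d)) 1) h"
    using z by (intro sw_eqv) (auto simp: target_space_def intro!: sw_eps_t(2)[OF b1])
  also have "\<dots> \<approx> sw s (\<lambda>a b. f (a * z) b) (h * 1)"
    using M.eqv_sym[OF sw_mult[OF b2, of h 1]] by (simp add: mult.assoc)
  finally show ?thesis by simp
qed

text \<open>As for \<open>H\<^sub>t\<close>, using \<open>1\<^sub>1 \<otimes> 1\<^sub>2 y\<close>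
  for multiplication by \<open>y\<close> on the right and
  \<open>1\<^sub>1 \<otimes> y 1\<^sub>2\<close> on the left. In the second case the sum over
  \<open>\<Delta> y\<close> is first brought inside.\<close>

lemma sw_mult_source:
  assumes f: "bilin s N f" and y: "y \<in> source_space scale \<Delta> \<epsilon>"
  shows "sw s f (h * y) \<approx> sw s (\<lambda>a b. f a (b * y)) h" "sw s f (y * h) \<approx> sw s (\<lambda>a b. f a (y * b)) h"
proof -
  have b1: "bilin s N (\<lambda>a b. f (p * a) (q * b))" for p q
    using bilin_mult[OF f, of p 1 q 1] by simp
  have b2: "bilin s N (\<lambda>a b. f (a * p) (b * q))" for p q
    using bilin_mult[OF f, of 1 p 1 q] by simp
  have b3: "bilin s N (\<lambda>a b. f a (y * b))"
    using bilin_mult[OF f, of 1 1 y 1] by simp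
  have b4: "bilin s N (\<lambda>a b. f a (b * y))"
    using bilin_mult[OF f, of 1 1 1 y] by simp
  have "sw s f (h * y) \<approx> sw s (\<lambda>a b. sw s (\<lambda>c d. f (a * c) (b * d)) y) h"
    by (rule sw_mult[OF f])
  also have "\<dots> \<approx> sw s (\<lambda>a b. sw s (\<lambda>c d. f (a * c) (b * (d * y))) 1) h"
    using y by (intro sw_eqv) (auto simp: source_space_def intro!: sw_eps_s(1)[OF b1])
  also have "\<dots> \<approx> sw s (\<lambda>a b. f a (b * y)) (h * 1)"
    using M.eqv_sym[OF sw_mult[OF b4, of h 1]] by (simp add: mult.assoc)
  finally show "sw s f (h * y) \<approx> sw s (\<lambda>a b. f a (b * y)) h" by simp
  have "sw s f (y * h) \<approx> sw s (\<lambda>a b. sw s (\<lambda>c d. f (a * c) (b * d)) h) y"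
    by (rule sw_mult[OF f])
  also have "\<dots> = sw s (\<lambda>c d. sw s (\<lambda>a b. f (a * c) (b * d)) y) h"
    by (rule sw_commute[OF module_s])
  also have "\<dots> \<approx> sw s (\<lambda>c d. sw s (\<lambda>a b. f (a * c) (y * b * d)) 1) h"
    using y by (intro sw_eqv) (auto simp: source_space_def intro!: sw_eps_s(2)[OF b2])
  also have "\<dots> = sw s (\<lambda>a b. sw s (\<lambda>c d. f (a * c) (y * b * d)) h) 1"
    by (rule sw_commute[OF module_s])
  also have "\<dots> \<approx> sw s (\<lambda>a b. f a (y * b)) (1 * h)"
    using M.eqv_sym[OF sw_mult[OF b3, of 1 h]] by (simp add: mult.assoc)
  finally show "sw s f (y * h) \<approx> sw s (\<lambda>a b. f a (y * b)) h" by simp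
qed

end

section \<open>Counital maps and the dual\<close>

lemma module_ring: "module ((*) :: 'k::comm_ring_1 \<Rightarrow> 'k \<Rightarrow> 'k)"
  by unfold_locales (simp_all add: algebra_simps)

lemma module_mod_eqv_zero:
  fixes s :: "'k::comm_ring_1 \<Rightarrow> 'v \<Rightarrow> 'v::ab_group_add"
  assumes "module s"
  shows "module_mod.eqv {0 :: 'v} = (=)"
  using module_mod.eqv_def[OF module_mod_zero[OF assms]] by (simp add: fun_eq_iff)

text \<open>Scalar-valued sums. Modulo \<open>{0}\<close> congruence is equality, so the rewriting
  turns the lemmas above into equations; \<open>V\<close> below does the same for sums with values
  in H.\<close>

sublocale weak_bialgebra \<subseteq> K: weak_bialgebra_mod scale \<Delta> \<epsilon> "(*)" "{0}"
  rewrites "module_mod.eqv {0 :: 'k} = (=)"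
  by (simp_all add: weak_bialgebra_mod_def weak_bialgebra_axioms module_mod_zero module_ring
      module_mod_eqv_zero[OF module_ring])

sublocale weak_bialgebra \<subseteq> V: weak_bialgebra_mod scale \<Delta> \<epsilon> scale "{0}"
  rewrites "module_mod.eqv {0 :: 'h} = (=)"
  by (simp_all add: weak_bialgebra_mod_def weak_bialgebra_axioms module_mod_zero module_scale
      module_mod_eqv_zero[OF module_scale])

context weak_bialgebra
begin

declare K.M.scale_scale [simp del] \<comment> \<open>a reassociation rule for \<open>(*)\<close> that loops with \<open>mult.assoc\<close>\<close>

lemma counit_add [simp]: "\<epsilon> (a + b) = \<epsilon> a + \<epsilon> b"
  using module_hom.add[OF counit_linear] .

lemma counit_scale [simp]: "\<epsilon> (scale c a) = c * \<epsilon> a"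
  using module_hom.scale[OF counit_linear] .

lemma scale_mult [simp]: "scale c a * b = scale c (a * b)" "a * scale c b = scale c (a * b)"
  by (simp_all add: scale_mult_left flip: scale_mult_right)

lemmas scalar_ac =
  mult.assoc[where 'a = 'k] mult.commute[where 'a = 'k] mult.left_commute[where 'a = 'k]

lemmas distribs = distrib_left distrib_right scale_left_distrib scale_right_distrib

lemma sw_counit_left: "sw scale (\<lambda>a b. scale (\<epsilon> a) b) h = h"
  using counit_left[of h] by (simp only: t_lift_sw)

lemma sw_counit_right: "sw scale (\<lambda>a b. scale (\<epsilon> b) a) h = h"
  using counit_right[of h] by (simp only: t_lift_sw)

lemma sw_counit_mult: "sw (*) (\<lambda>a b. \<epsilon> (h * a) * \<epsilon> (b * l)) m = \<epsilon> (h * m * l)"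
  using counit_mult[of h m l] by (simp only: t_lift_sw)

lemma sw_counit_mult': "sw (*) (\<lambda>a b. \<epsilon> (h * b) * \<epsilon> (a * l)) m = \<epsilon> (h * m * l)"
  using counit_mult'[of h m l] by (simp only: t_lift_sw)

lemma sw_mult_left: "p * sw scale f h = sw scale (\<lambda>a b. p * f a b) h"
  by (rule module_hom_sw) (unfold_locales, simp_all add: distribs)

lemma sw_mult_right: "sw scale f h * p = sw scale (\<lambda>a b. f a b * p) h"
  by (rule module_hom_sw) (unfold_locales, simp_all add: distribs)

lemma scale_sw: "scale (sw (*) f h) v = sw scale (\<lambda>a b. scale (f a b) v) h"
  by (rule module_hom_sw) (unfold_locales, simp_all add: distribs)

lemma counit_mult_sw: "\<epsilon> (x * sw scale f h) = sw (*) (\<lambda>a b. \<epsilon> (x * f a b)) h"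
  by (rule module_hom_sw[OF counit_hom_left])

lemma counit_sw_mult: "\<epsilon> (sw scale f h * x) = sw (*) (\<lambda>a b. \<epsilon> (f a b * x)) h"
  by (rule module_hom_sw[OF counit_hom_right])

lemma eps_t_sw: "eps_t scale \<Delta> \<epsilon> h = sw scale (\<lambda>a b. scale (\<epsilon> (a * h)) b) 1"
  by (simp only: eps_t_def t_lift_sw)

lemma eps_s_sw: "eps_s scale \<Delta> \<epsilon> h = sw scale (\<lambda>a b. scale (\<epsilon> (h * b)) a) 1"
  by (simp only: eps_s_def t_lift_sw)

text \<open>Expanding \<open>eps_s\<close> gives
  \<open>\<epsilon> (h 1\<^sub>2) \<epsilon> (1\<^sub>1 x)\<close>, the second splitting axiom for
  \<epsilon> with middle factor 1. The next lemma rests on the same axiom.\<close>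

lemma counit_eps_s_mult: "\<epsilon> (eps_s scale \<Delta> \<epsilon> h * x) = \<epsilon> (h * x)"
  using sw_counit_mult'[of h x 1] by (simp add: eps_s_sw counit_sw_mult)

lemma counit_mult_eps_t: "\<epsilon> (x * eps_t scale \<Delta> \<epsilon> h) = \<epsilon> (x * h)"
  using sw_counit_mult'[of x h 1] by (simp add: eps_t_sw counit_mult_sw mult.commute)

text \<open>The map \<open>T\<close> of the introduction: the target counital map of the co-opposite weak bialgebra.\<close>

definition eps_t_cop :: "'h \<Rightarrow> 'h" where
  "eps_t_cop h = sw scale (\<lambda>a b. scale (\<epsilon> (h * a)) b) 1"

lemma eps_t_cop_hom: "module_hom scale scale eps_t_cop"
proof (intro module_hom.intro module_hom_axioms.intro module_scale)
  have *: "lin_mod scale UNIV scale {0} eps_t_cop"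
    unfolding eps_t_cop_def by (intro V.lin_mod_sw V.lin_mod_coeff counit_hom_right)
  show "eps_t_cop (a + b) = eps_t_cop a + eps_t_cop b"
    "eps_t_cop (scale c a) = scale c (eps_t_cop a)" for a b c
    using * by (simp_all add: lin_mod_zero_iff)
qed

lemma bilin_counit_left: "bilin scale {0} (\<lambda>a b. scale (\<epsilon> (x * a)) b)"
  by (simp add: bilin_def lin_mod_zero_iff distribs mult.commute)

text \<open>
  Write \<open>h = 1 h\<close> and split \<open>\<epsilon> (x 1\<^sub>1 h\<^sub>1) = \<epsilon> (x 1\<^sub>1) \<epsilon> (1\<^sub>2 h\<^sub>1)\<close>; the rest collapses by the counit
  axiom for \<open>1\<^sub>2 h\<close>.
\<close>

lemma eps_t_cop_mult: "eps_t_cop x * h = sw scale (\<lambda>a b. scale (\<epsilon> (x * a)) b) h"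
proof -
  let ?G = "\<lambda>p q b. sw scale (\<lambda>c d. scale (\<epsilon> (x * p) * \<epsilon> (q * c)) (b * d)) h"
  have b': "bilin scale {0} (\<lambda>a b. scale (\<epsilon> a) b)"
    using bilin_counit_left[of 1] by simp
  have tri: "trilin scale {0} ?G"
    unfolding trilin_def bilin_def
    by (intro conjI allI V.lin_mod_sw) (simp_all add: lin_mod_zero_iff distribs scalar_ac)
  have inner: "sw scale (?G p) b = scale (\<epsilon> (x * p)) (b * h)" for p b
  proof -
    have "sw scale (?G p) b
        = scale (\<epsilon> (x * p)) (sw scale (\<lambda>q b. sw scale (\<lambda>c d. scale (\<epsilon> (q * c)) (b * d)) h) b)"
      by (simp add: V.scaled_sw)
    also have "\<dots> = scale (\<epsilon> (x * p)) (b * h)"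
      using V.sw_mult[OF b', of b h] by (simp add: sw_counit_left)
    finally show ?thesis .
  qed
  have swap: "sw scale (\<lambda>c d. sw scale (\<lambda>p q. scale (\<epsilon> (x * p) * \<epsilon> (q * c)) (b * d)) a) h
      = sw scale (\<lambda>p q. ?G p q b) a" for a b
    by (rule sw_commute[OF module_scale])
  have expand: "scale (\<epsilon> (x * (a * c))) v
      = sw scale (\<lambda>p q. scale (\<epsilon> (x * p) * \<epsilon> (q * c)) v) a" for a c v
    using scale_sw[of "\<lambda>p q. \<epsilon> (x * p) * \<epsilon> (q * c)" a v] sw_counit_mult[of x c a]
    by (simp add: mult.assoc)
  have "sw scale (\<lambda>a b. scale (\<epsilon> (x * a)) b) (1 * h)
      = sw scale (\<lambda>a b. sw scale (\<lambda>c d. scale (\<epsilon> (x * (a * c))) (b * d)) h) 1"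
    by (rule V.sw_mult[OF bilin_counit_left])
  also have "\<dots> = sw scale (\<lambda>a b. sw scale (\<lambda>c d.
      sw scale (\<lambda>p q. scale (\<epsilon> (x * p) * \<epsilon> (q * c)) (b * d)) a) h) 1"
    by (simp only: expand)
  also have "\<dots> = sw3 scale ?G 1"
    by (simp only: swap sw3_def)
  also have "\<dots> = sw scale (\<lambda>a b. sw scale (?G a) b) 1"
    by (rule V.sw_coassoc[OF tri])
  also have "\<dots> = eps_t_cop x * h"
    by (simp add: inner eps_t_cop_def sw_mult_right)
  finally show ?thesis by simp
qed

text \<open>The counit law and \<open>\<Delta> z = z 1\<^sub>1 \<otimes> 1\<^sub>2\<close> give
  \<open>z = \<epsilon> z\<^sub>1 z\<^sub>2 = \<epsilon> (z 1\<^sub>1) 1\<^sub>2\<close>.\<close>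

lemma eps_t_cop_target:
  assumes "z \<in> target_space scale \<Delta> \<epsilon>"
  shows "eps_t_cop z = z"
proof -
  have "z = sw scale (\<lambda>a b. scale (\<epsilon> (1 * a)) b) z"
    by (simp add: sw_counit_left)
  also have "\<dots> = eps_t_cop z"
    using assms V.sw_eps_t(1)[OF bilin_counit_left[of 1]]
    by (auto simp: target_space_def eps_t_cop_def)
  finally show ?thesis by simp
qed

text \<open>Since \<open>z 1\<^sub>1 \<otimes> 1\<^sub>2 = \<Delta> z\<close>, the left side is
  \<open>\<epsilon> (x z\<^sub>1) z\<^sub>2\<close>, to which \<open>eps_t_cop_mult\<close>
  applies.\<close>

lemma eps_t_cop_mult_target:
  assumes "z \<in> target_space scale \<Delta> \<epsilon>"
  shows "eps_t_cop (x * z) = eps_t_cop x * z"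
  using assms V.sw_eps_t(1)[OF bilin_counit_left[of x]]
  by (auto simp: target_space_def eps_t_cop_def[of "x * _"] eps_t_cop_mult mult.assoc)

text \<open>The sum unfolds to \<open>\<epsilon> (h\<^sub>1 1\<^sub>1) h\<^sub>2 1\<^sub>2\<close>,
  which is the counit law for \<open>\<Delta> (h 1)\<close>. The next lemma uses the other counit
  law in the same way.\<close>

lemma sw_eps_t_cop: "sw scale (\<lambda>a b. b * eps_t_cop a) h = h"
  using V.sw_mult[OF bilin_counit_left[of 1], of h 1]
  by (simp add: eps_t_cop_def sw_mult_left sw_counit_left)

lemma sw_eps_s: "sw scale (\<lambda>a b. a * eps_s scale \<Delta> \<epsilon> b) h = h"
proof -
  have "bilin scale {0} (\<lambda>a b. scale (\<epsilon> b) a)"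
    by (simp add: bilin_def lin_mod_zero_iff distribs mult.commute)
  from V.sw_mult[OF this, of h 1] show ?thesis
    by (simp add: eps_s_sw sw_mult_left sw_counit_right)
qed

section \<open>Convolution and the actions of H on its dual\<close>

lemma conv_sw: "conv \<Delta> f g = (\<lambda>h. sw (*) (\<lambda>a b. f a * g b) h)"
  by (simp only: conv_def t_lift_sw)

lemma dual_iff: "f \<in> dual scale \<longleftrightarrow> lin_mod scale UNIV (*) {0} f"
  by (auto simp: dual_def lin_mod_zero_iff module_hom_iff module_scale module_ring)

lemma dual_add: "f \<in> dual scale \<Longrightarrow> f (a + b) = f a + f b"
  by (simp add: dual_iff lin_mod_zero_iff)

lemma dual_scale_arg: "f \<in> dual scale \<Longrightarrow> f (scale c a) = c * f a"
  by (simp add: dual_iff lin_mod_zero_iff)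

lemma counit_dual [simp]: "\<epsilon> \<in> dual scale"
  by (simp add: dual_def counit_linear)

lemma left_act_dual [simp]:
  assumes "f \<in> dual scale"
  shows "left_act a f \<in> dual scale"
  unfolding dual_iff left_act_def
  by (simp add: lin_mod_zero_iff distribs dual_add[OF assms] dual_scale_arg[OF assms])

lemma right_act_dual [simp]:
  assumes "f \<in> dual scale"
  shows "right_act f a \<in> dual scale"
  unfolding dual_iff right_act_def
  by (simp add: lin_mod_zero_iff distribs dual_add[OF assms] dual_scale_arg[OF assms])

lemma bilin_conv:
  assumes "f \<in> dual scale" "g \<in> dual scale"
  shows "bilin (*) {0} (\<lambda>a b. f a * g b)"
  by (simp add: bilin_def lin_mod_zero_iff distribs scalar_ac assms[THEN dual_add]
      assms[THEN dual_scale_arg])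

lemma conv_dual [simp]:
  assumes "f \<in> dual scale" "g \<in> dual scale"
  shows "conv \<Delta> f g \<in> dual scale"
  unfolding conv_sw dual_iff by (rule K.lin_mod_sw_arg[OF bilin_conv[OF assms]])

lemma conv_assoc:
  assumes "f \<in> dual scale" "g \<in> dual scale" "h \<in> dual scale"
  shows "conv \<Delta> (conv \<Delta> f g) h = conv \<Delta> f (conv \<Delta> g h)"
proof
  fix x
  have tri: "trilin (*) {0} (\<lambda>a b c. f a * g b * h c)"
    by (simp add: trilin_def bilin_def lin_mod_zero_iff distribs scalar_ac assms[THEN dual_add]
      assms[THEN dual_scale_arg])
  have "conv \<Delta> (conv \<Delta> f g) h x = sw3 (*) (\<lambda>a b c. f a * g b * h c) x"
    by (simp add: conv_sw sw3_def mult.commute[of _ "h _"] K.scaled_sw)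
  also have "\<dots> = sw (*) (\<lambda>a b. sw (*) (\<lambda>c d. f a * g c * h d) b) x"
    by (rule K.sw_coassoc[OF tri])
  also have "\<dots> = conv \<Delta> f (conv \<Delta> g h) x"
    by (simp add: conv_sw K.scaled_sw mult.assoc)
  finally show "conv \<Delta> (conv \<Delta> f g) h x = conv \<Delta> f (conv \<Delta> g h) x" .
qed

text \<open>At \<open>l\<close> the convolution is
  \<open>\<epsilon> (l\<^sub>1 z) \<epsilon> (y l\<^sub>2)\<close>, the second splitting of
  \<open>\<epsilon> (y l z)\<close>.\<close>

lemma conv_left_right_act_counit:
  "conv \<Delta> (left_act z \<epsilon>) (right_act \<epsilon> y) = right_act (left_act z \<epsilon>) y"
  using sw_counit_mult'[of y z] by (simp add: fun_eq_iff conv_sw left_act_def right_act_def mult.commute)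

text \<open>For \<open>a\<close> in \<open>H\<^sub>t\<close>,
  \<open>x\<^sub>1 a \<otimes> x\<^sub>2 = \<Delta> (x a)\<close>; hence
  \<open>\<epsilon> (c x\<^sub>1 a) \<epsilon> (x\<^sub>2 z)\<close> is the first splitting of
  \<open>\<epsilon> (c x a z)\<close>.\<close>

lemma conv_act_left_act_counit:
  assumes "a \<in> target_space scale \<Delta> \<epsilon>"
  shows "conv \<Delta> (right_act (left_act a \<epsilon>) c) (left_act z \<epsilon>) = right_act (left_act (a * z) \<epsilon>) c"
proof
  fix x
  have "bilin (*) {0} (\<lambda>p q. \<epsilon> (c * p) * \<epsilon> (q * z))"
    by (simp add: bilin_def lin_mod_zero_iff distribs scalar_ac)
  from K.sw_mult_target[OF this assms, of x]
  show "conv \<Delta> (right_act (left_act a \<epsilon>) c) (left_act z \<epsilon>) x = right_act (left_act (a * z) \<epsilon>) c x"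
    by (simp add: sw_counit_mult conv_sw left_act_def right_act_def mult.assoc)
qed

text \<open>Because \<open>x\<^sub>1 \<otimes> y x\<^sub>2 = \<Delta> (y x)\<close>, the counit law
  reduces \<open>\<epsilon> (c x\<^sub>1 a) \<epsilon> (y x\<^sub>2)\<close> to
  \<open>\<epsilon> (c y x a)\<close>.\<close>

lemma conv_act_right_act_counit:
  assumes "y \<in> source_space scale \<Delta> \<epsilon>"
  shows "conv \<Delta> (right_act (left_act a \<epsilon>) c) (right_act \<epsilon> y) = right_act (left_act a \<epsilon>) (c * y)"
proof
  fix x
  have "bilin (*) {0} (\<lambda>p q. \<epsilon> (c * p * a) * \<epsilon> q)"
    by (simp add: bilin_def lin_mod_zero_iff distribs scalar_ac)
  from K.sw_mult_source(2)[OF this assms, of x]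
  have "conv \<Delta> (right_act (left_act a \<epsilon>) c) (right_act \<epsilon> y) x
      = sw (*) (\<lambda>p q. \<epsilon> (c * scale (\<epsilon> q) p * a)) (y * x)"
    by (simp add: conv_sw left_act_def right_act_def mult.assoc mult.commute)
  also have "\<dots> = \<epsilon> (c * sw scale (\<lambda>p q. scale (\<epsilon> q) p) (y * x) * a)"
    by (simp add: sw_mult_left counit_sw_mult mult.assoc)
  finally show "conv \<Delta> (right_act (left_act a \<epsilon>) c) (right_act \<epsilon> y) x
      = right_act (left_act a \<epsilon>) (c * y) x"
    by (simp add: sw_counit_right left_act_def right_act_def mult.assoc)
qed

end

section \<open>The antipode and the two target counital maps\<close>

context weak_hopf_algebra
begin

text \<open>
  \<open>\<epsilon> (h\<^sub>1 S h\<^sub>2 x) = \<epsilon> (\<epsilon>\<^sub>s h\<^sub>1 S h\<^sub>2 x) = \<epsilon> (S h\<^sub>1 h\<^sub>2 S h\<^sub>3 x)\<close>.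
\<close>

lemma counit_antipode_mult: "\<epsilon> (S h * x) = \<epsilon> (eps_t scale \<Delta> \<epsilon> h * x)"
proof -
  have inner: "\<epsilon> (a * S b * x) = sw (*) (\<lambda>p q. \<epsilon> (S p * q * S b * x)) a" for a b
  proof -
    have "\<epsilon> (a * S b * x) = \<epsilon> (eps_s scale \<Delta> \<epsilon> a * (S b * x))"
      by (simp add: counit_eps_s_mult mult.assoc)
    also have "eps_s scale \<Delta> \<epsilon> a = sw scale (\<lambda>p q. S p * q) a"
      using antipode_left[of a] by (simp only: t_lift_sw)
    finally show ?thesis by (simp add: counit_sw_mult mult.assoc)
  qed
  have "eps_t scale \<Delta> \<epsilon> h = sw scale (\<lambda>a b. a * S b) h"
    using antipode_right[of h] by (simp only: t_lift_sw)
  then have "\<epsilon> (eps_t scale \<Delta> \<epsilon> h * x) = sw (*) (\<lambda>a b. \<epsilon> (a * S b * x)) h"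
    by (simp add: counit_sw_mult)
  also have "\<dots> = sw3 (*) (\<lambda>p q b. \<epsilon> (S p * q * S b * x)) h"
    unfolding sw3_def by (rule arg_cong[where f = "\<lambda>f. sw (*) f h"]) (intro ext inner)
  also have "\<dots> = \<epsilon> (sw3 scale (\<lambda>p q b. S p * q * S b) h * x)"
    by (simp add: sw3_def counit_sw_mult)
  also have "sw3 scale (\<lambda>p q b. S p * q * S b) h = S h"
    using antipode_mid[of h] by (simp only: lin_ext_comul3[OF module_scale])
  finally show ?thesis by simp
qed

text \<open>\<open>eps_t_cop\<close> sees its argument \<open>u\<close> only through the functional
  sending \<open>x\<close> to \<open>\<epsilon> (u x)\<close>, and this is the same for
  \<open>S h\<close> and for \<open>eps_t\<close> of \<open>h\<close>; the latter lies in
  \<open>H\<^sub>t\<close> and is fixed.\<close>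

lemma eps_t_eq_eps_t_cop_antipode: "eps_t scale \<Delta> \<epsilon> h = eps_t_cop (S h)"
proof -
  have "eps_t scale \<Delta> \<epsilon> h = eps_t_cop (eps_t scale \<Delta> \<epsilon> h)"
    by (rule eps_t_cop_target[symmetric]) (simp add: target_space_def)
  then show ?thesis by (simp add: eps_t_cop_def counit_antipode_mult)
qed

end

section \<open>The projection of the double\<close>

lemma subspace_keys: "free_module.subspace {x :: 'g \<Rightarrow>\<^sub>0 'k::comm_ring_1. Poly_Mapping.keys x \<subseteq> K}"
proof (rule free_module.subspaceI)
  fix x y :: "'g \<Rightarrow>\<^sub>0 'k" and c :: 'k
  assume x: "x \<in> {x. Poly_Mapping.keys x \<subseteq> K}"
  have "Poly_Mapping.keys (free_scale c x) \<subseteq> Poly_Mapping.keys x"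
    by (auto simp: in_keys_iff)
  with x show "free_scale c x \<in> {x. Poly_Mapping.keys x \<subseteq> K}" by blast
  assume "y \<in> {x. Poly_Mapping.keys x \<subseteq> K}"
  with x show "x + y \<in> {x. Poly_Mapping.keys x \<subseteq> K}"
    using Poly_Mapping.keys_add[of x y] by blast
qed simp

lemma keys_linear_rels:
  fixes sA :: "'k::comm_ring_1 \<Rightarrow> 'a \<Rightarrow> 'a::ab_group_add"
  assumes r: "r \<in> linear_rels sA A ins"
    and A: "\<And>a a'. a \<in> A \<Longrightarrow> a' \<in> A \<Longrightarrow> a + a' \<in> A" "\<And>c a. a \<in> A \<Longrightarrow> sA c a \<in> A"
    and ins: "\<And>a. a \<in> A \<Longrightarrow> ins a \<in> L"
  shows "Poly_Mapping.keys r \<subseteq> L"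
proof -
  define K where "K = {x :: _ \<Rightarrow>\<^sub>0 'k. Poly_Mapping.keys x \<subseteq> L}"
  have sub: "free_module.subspace K"
    unfolding K_def by (rule subspace_keys)
  have single: "Poly_Mapping.single (ins a) 1 \<in> K" if "a \<in> A" for a
    using ins[OF that] by (simp add: K_def)
  have "r \<in> K"
    using r A unfolding linear_rels_def
    by (auto intro!: free_module.subspace_diff[OF sub] free_module.subspace_add[OF sub]
        free_module.subspace_scale[OF sub] single)
  then show ?thesis by (simp add: K_def)
qed

text \<open>All generating relations are supported on \<open>A \<times> B\<close>, so changing the
  representative does not leave that support. In the double this keeps the second components linear
  functionals.\<close>

lemma keys_rel2:
  assumes x: "x \<in> rel2 sA A sB B"
    and A: "\<And>a a'. a \<in> A \<Longrightarrow> a' \<in> A \<Longrightarrow> a + a' \<in> A" "\<And>c a. a \<in> A \<Longrightarrow> sA c a \<in> A"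
    and B: "\<And>b b'. b \<in> B \<Longrightarrow> b' \<in> B \<Longrightarrow> b + b' \<in> B" "\<And>c b. b \<in> B \<Longrightarrow> sB c b \<in> B"
  shows "Poly_Mapping.keys x \<subseteq> A \<times> B"
  using x unfolding rel2_def
proof (induction rule: free_module.span_induct)
  case base
  show ?case by (rule subspace_keys)
next
  case (step x)
  from step(1) show ?case
  proof (elim UnE UN_E)
    fix b assume "b \<in> B" "x \<in> linear_rels sA A (\<lambda>a. (a, b))"
    then show ?thesis by (intro keys_linear_rels[of x sA A "\<lambda>a. (a, b)"] A) auto
  next
    fix a assume "a \<in> A" "x \<in> linear_rels sB B (\<lambda>b. (a, b))"
    then show ?thesis by (intro keys_linear_rels[of x sB B "\<lambda>b. (a, b)"] B) auto
  qed
qed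

lemma lin_mod_comp:
  assumes "lin_mod sB B s N f" and "\<And>a. a \<in> A \<Longrightarrow> g a \<in> B"
    and "\<And>a a'. a \<in> A \<Longrightarrow> a' \<in> A \<Longrightarrow> g (a + a') = g a + g a'"
    and "\<And>c a. a \<in> A \<Longrightarrow> g (sA c a) = sB c (g a)"
  shows "lin_mod sA A s N (\<lambda>a. f (g a))"
  using assms by (simp add: lin_mod_def)

lemma lin_mod_mono: "lin_mod sA A s N f \<Longrightarrow> N \<subseteq> N' \<Longrightarrow> lin_mod sA A s N' f"
  by (auto simp: lin_mod_def)

lemma module_free_scale: "module free_scale"
  by unfold_locales

section \<open>Iterated coproducts of products with elements of \<open>H\<^sub>t\<close> and
  \<open>H\<^sub>s\<close>\<close>

context weak_bialgebra_mod
begin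

lemma bilin_sw3_outer:
  assumes "trilin s N f"
  shows "bilin s N (\<lambda>a c. sw s (\<lambda>p q. f p q c) a)"
  using assms
  by (auto simp: bilin_def trilin_def intro!: lin_mod_sw lin_mod_sw_arg)

text \<open>The outer splitting puts \<open>z\<close> on the left leg; splitting that leg again puts
  it on the first of the three.\<close>

lemma sw3_mult_target:
  assumes f: "trilin s N f" and z: "z \<in> target_space scale \<Delta> \<epsilon>"
  shows "sw3 s f (h * z) \<approx> sw3 s (\<lambda>a b c. f (a * z) b c) h"
proof -
  have b: "bilin s N (\<lambda>p q. f p q c)" for c
    using f by (simp add: bilin_def trilin_def)
  have "sw3 s f (h * z) \<approx> sw s (\<lambda>a c. sw s (\<lambda>p q. f p q c) (a * z)) h"
    unfolding sw3_def by (rule sw_mult_target[OF bilin_sw3_outer[OF f] z])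
  also have "\<dots> \<approx> sw3 s (\<lambda>a b c. f (a * z) b c) h"
    unfolding sw3_def by (rule sw_eqv) (rule sw_mult_target[OF b z])
  finally show ?thesis .
qed

text \<open>One application suffices: \<open>y\<close> lands on the right leg, which
  \<open>sw3\<close> does not split again.\<close>

lemma sw3_mult_source:
  assumes f: "trilin s N f" and y: "y \<in> source_space scale \<Delta> \<epsilon>"
  shows "sw3 s f (h * y) \<approx> sw3 s (\<lambda>a b c. f a b (c * y)) h"
  unfolding sw3_def by (rule sw_mult_source(1)[OF bilin_sw3_outer[OF f] y])

lemma sw3_eqv: "(\<And>a b c. f a b c \<approx> g a b c) \<Longrightarrow> sw3 s f h \<approx> sw3 s g h"
  unfolding sw3_def by (intro sw_eqv)

lemma sw3_apply:
  assumes "lin_mod scale UNIV s N g"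
  shows "g (sw3 scale f h) \<approx> sw3 s (\<lambda>a b c. g (f a b c)) h"
proof -
  have "g (sw3 scale f h) \<approx> sw s (\<lambda>a c. g (sw scale (\<lambda>p q. f p q c) a)) h"
    unfolding sw3_def by (rule sw_apply[OF assms module_scale])
  also have "\<dots> \<approx> sw3 s (\<lambda>a b c. g (f a b c)) h"
    unfolding sw3_def by (intro sw_eqv sw_apply[OF assms module_scale])
  finally show ?thesis .
qed

end

text \<open>Here congruence means that two free representatives have the same coset in
  \<open>H \<bowtie> H\<^sup>*\<close>.\<close>

sublocale weak_bialgebra \<subseteq> D: weak_bialgebra_mod scale \<Delta> \<epsilon> free_scale "double_rel scale"
  by (simp add: weak_bialgebra_mod_def weak_bialgebra_axioms module_mod_def module_mod_axioms_def
      module_free_scale double_rel_def rel2_def)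

sublocale weak_bialgebra \<subseteq> DR: free_submodule "double_rel scale"
  unfolding double_rel_def by (rule free_submodule_rel2)

section \<open>Free representatives for the projection and for the generators\<close>

context weak_bialgebra
begin

lemma sw_add_fun: "module s \<Longrightarrow> sw s (\<lambda>a b. f a b + g a b) h = sw s f h + sw s g h"
  by (simp add: sw_def lin_ext_def case_prod_unfold module.scale_right_distrib sum.distrib)

lemma conv_add_left: "conv \<Delta> (f + f') g = conv \<Delta> f g + conv \<Delta> f' g"
  by (simp add: fun_eq_iff conv_sw distrib_right sw_add_fun module_ring)

lemma conv_add_right: "conv \<Delta> f (g + g') = conv \<Delta> f g + conv \<Delta> f g'"
  by (simp add: fun_eq_iff conv_sw distrib_left sw_add_fun module_ring)

lemma conv_scale_left: "conv \<Delta> (dual_scale c f) g = dual_scale c (conv \<Delta> f g)"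
  by (simp add: fun_eq_iff conv_sw dual_scale_def K.scaled_sw mult.assoc)

lemma conv_scale_right: "conv \<Delta> f (dual_scale c g) = dual_scale c (conv \<Delta> f g)"
  by (simp add: fun_eq_iff conv_sw dual_scale_def K.scaled_sw mult.left_commute)

lemmas conv_linear = conv_add_left conv_add_right conv_scale_left conv_scale_right

lemma dual_plus: "f \<in> dual scale \<Longrightarrow> g \<in> dual scale \<Longrightarrow> f + g \<in> dual scale"
  by (auto simp: dual_iff lin_mod_zero_iff distribs)

lemma dual_dual_scale: "f \<in> dual scale \<Longrightarrow> dual_scale c f \<in> dual scale"
  by (auto simp: dual_iff lin_mod_zero_iff distribs dual_scale_def mult.left_commute)

lemma keys_double_rel: "x \<in> double_rel scale \<Longrightarrow> Poly_Mapping.keys x \<subseteq> UNIV \<times> dual scale"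
  unfolding double_rel_def by (erule keys_rel2) (auto intro: dual_plus dual_dual_scale)

lemma lin_mod_single_left:
  "g \<in> dual scale \<Longrightarrow>
    lin_mod scale UNIV free_scale (double_rel scale) (\<lambda>a. Poly_Mapping.single (a, g) 1)"
  by (force simp: lin_mod_def double_rel_def rel2_def linear_rels_def intro!: free_module.span_base)

lemma lin_mod_single_right:
  "lin_mod dual_scale (dual scale) free_scale (double_rel scale) (\<lambda>g. Poly_Mapping.single (a, g) 1)"
  by (force simp: lin_mod_def double_rel_def rel2_def linear_rels_def intro!: free_module.span_base)

abbreviation counit_act :: "'h \<Rightarrow> 'h \<Rightarrow> 'h \<Rightarrow> 'k" where
  "counit_act a c \<equiv> right_act (left_act a \<epsilon>) c"

text \<open>A representative of \<open>p (l \<bowtie> g)\<close> in which \<open>eps_t_cop\<close>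
  has replaced \<open>inv S\<close>; \<open>counit_act_inv_antipode\<close> justifies the
  replacement.\<close>

definition proj_gen :: "'h \<Rightarrow> ('h \<Rightarrow> 'k) \<Rightarrow> ('h \<times> ('h \<Rightarrow> 'k) \<Rightarrow>\<^sub>0 'k)" where
  "proj_gen l g = sw3 free_scale
     (\<lambda>a b c. Poly_Mapping.single (b, conv \<Delta> (counit_act (eps_t_cop a) c) g) 1) l"

lemma trilin_proj_gen:
  assumes "g \<in> dual scale"
  shows "trilin free_scale (double_rel scale)
    (\<lambda>a b c. Poly_Mapping.single (b, conv \<Delta> (counit_act (eps_t_cop a) c) g) 1)"
  unfolding trilin_def bilin_def
proof (intro conjI allI)
  interpret T: module_hom scale scale eps_t_cop by (rule eps_t_cop_hom)
  fix a b c
  show "lin_mod scale UNIV free_scale (double_rel scale)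
      (\<lambda>b. Poly_Mapping.single (b, conv \<Delta> (counit_act (eps_t_cop a) c) g) 1)"
    by (rule lin_mod_single_left) (simp add: assms)
  have "counit_act (eps_t_cop (a + a')) c = counit_act (eps_t_cop a) c + counit_act (eps_t_cop a') c"
    "counit_act (eps_t_cop (scale d a)) c = dual_scale d (counit_act (eps_t_cop a) c)" for a a' d
    by (simp_all add: fun_eq_iff left_act_def right_act_def dual_scale_def T.add T.scale distribs)
  then show "lin_mod scale UNIV free_scale (double_rel scale)
      (\<lambda>a. Poly_Mapping.single (b, conv \<Delta> (counit_act (eps_t_cop a) c) g) 1)"
    by (intro lin_mod_comp[OF lin_mod_single_right]) (simp_all add: assms conv_linear)
  have "counit_act a (c + c') = counit_act a c + counit_act a c'"
    "counit_act a (scale d c) = dual_scale d (counit_act a c)" for a c c' d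
    by (simp_all add: fun_eq_iff left_act_def right_act_def dual_scale_def distribs)
  then show "lin_mod scale UNIV free_scale (double_rel scale)
      (\<lambda>c. Poly_Mapping.single (b, conv \<Delta> (counit_act (eps_t_cop a) c) g) 1)"
    by (intro lin_mod_comp[OF lin_mod_single_right]) (simp_all add: assms conv_linear)
qed

lemma lin_mod_proj_gen_right:
  "lin_mod dual_scale (dual scale) free_scale (double_rel scale) (proj_gen l)"
  unfolding proj_gen_def sw3_def
  by (intro D.lin_mod_sw lin_mod_comp[OF lin_mod_single_right]) (simp_all add: conv_linear)

lemma lin_ext_double_rel:
  assumes "\<And>g. g \<in> dual scale \<Longrightarrow>
      lin_mod scale UNIV free_scale (double_rel scale) (\<lambda>l. f l g)"
    and "\<And>l. lin_mod dual_scale (dual scale) free_scale (double_rel scale) (f l)"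
    and "x - y \<in> double_rel scale"
  shows "D.M.eqv (lin_ext free_scale (\<lambda>(l, g). f l g) x) (lin_ext free_scale (\<lambda>(l, g). f l g) y)"
  using D.M.lin_ext_rel2[where A = UNIV and sA = scale and B = "dual scale" and sB = dual_scale
      and f = "\<lambda>(l, g). f l g" and x = x and y = y] assms
  by (simp add: double_rel_def[symmetric])

lemma lin_mod_proj_gen_left:
  "g \<in> dual scale \<Longrightarrow>
    lin_mod scale UNIV free_scale (double_rel scale) (\<lambda>l. proj_gen l g)"
  unfolding proj_gen_def by (rule D.lin_mod_sw3[OF trilin_proj_gen])

lemma eps_t_target [simp]: "eps_t scale \<Delta> \<epsilon> h \<in> target_space scale \<Delta> \<epsilon>"
  by (simp add: target_space_def)

lemma eps_s_source [simp]: "eps_s scale \<Delta> \<epsilon> h \<in> source_space scale \<Delta> \<epsilon>"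
  by (simp add: source_space_def)

text \<open>Free representatives of the two families in the theorem. Together with
  \<open>double_rel\<close> they allow spans to be taken before passing to cosets.\<close>

definition ker_gens :: "('h \<times> ('h \<Rightarrow> 'k) \<Rightarrow>\<^sub>0 'k) set" where
  "ker_gens =
     {Poly_Mapping.single (h * z, f) 1 - Poly_Mapping.single (h, conv \<Delta> (left_act z \<epsilon>) f) 1 | h f z.
        f \<in> dual scale \<and> z \<in> target_space scale \<Delta> \<epsilon>}
   \<union> {Poly_Mapping.single (h * y, f) 1 - Poly_Mapping.single (h, conv \<Delta> (right_act \<epsilon> y) f) 1 | h f y.
        f \<in> dual scale \<and> y \<in> source_space scale \<Delta> \<epsilon>}"

text \<open>Ensures that the cosets of this span lie in \<open>double_carrier\<close>.\<close>

lemma keys_span_ker_gens: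
  assumes "x \<in> free_module.span (double_rel scale \<union> ker_gens)"
  shows "Poly_Mapping.keys x \<subseteq> UNIV \<times> dual scale"
  using assms
proof (induction rule: free_module.span_induct)
  case base
  show ?case by (rule subspace_keys)
next
  case (step x)
  show ?case
  proof (cases "x \<in> ker_gens")
    case True
    have keys: "Poly_Mapping.keys (Poly_Mapping.single (h, f) 1 - Poly_Mapping.single (h', f') (1 :: 'k))
        \<subseteq> UNIV \<times> dual scale" if "f \<in> dual scale" "f' \<in> dual scale" for h h' :: 'h and f f'
    proof -
      have "Poly_Mapping.keys (Poly_Mapping.single (h, f) 1 - Poly_Mapping.single (h', f') (1 :: 'k))
          \<subseteq> {(h, f), (h', f')}"
        by (rule order_trans[OF keys_diff]) simp
      with that show ?thesis by blast
    qed
    from True consider (target) h f z where "f \<in> dual scale"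
        "x = Poly_Mapping.single (h * z, f) 1 - Poly_Mapping.single (h, conv \<Delta> (left_act z \<epsilon>) f) 1"
      | (source) h f y where "f \<in> dual scale"
        "x = Poly_Mapping.single (h * y, f) 1 - Poly_Mapping.single (h, conv \<Delta> (right_act \<epsilon> y) f) 1"
      unfolding ker_gens_def by blast
    then show ?thesis
      by cases (simp_all only: keys conv_dual left_act_dual right_act_dual counit_dual)
  next
    case False
    with step(1) have "x \<in> double_rel scale" by blast
    then show ?thesis by (rule keys_double_rel)
  qed
qed

end

section \<open>The kernel of the projection\<close>

context weak_hopf_algebra
begin

context
  assumes bij_S: "bij S"
begin

text \<open>Surjectivity of \<open>S\<close> allows the previous comparison of counital maps to be
  read at \<open>inv S h\<close>. In particular \<open>eps_t_cop\<close> takes values in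
  \<open>H\<^sub>t\<close>.\<close>

lemma eps_t_inv_antipode: "eps_t scale \<Delta> \<epsilon> (inv S h) = eps_t_cop h"
  using bij_S by (simp add: eps_t_eq_eps_t_cop_antipode bij_is_surj surj_f_inv_f)

lemma eps_t_cop_in_target: "eps_t_cop h \<in> target_space scale \<Delta> \<epsilon>"
  by (simp flip: eps_t_inv_antipode)

text \<open>To the right of any factor under \<epsilon>, \<open>inv S a\<close> may be replaced by
  its image under \<open>eps_t\<close>, which is \<open>eps_t_cop a\<close>.\<close>

lemma counit_act_inv_antipode: "counit_act (inv S a) c = counit_act (eps_t_cop a) c"
  by (simp add: fun_eq_iff left_act_def right_act_def counit_mult_eps_t flip: eps_t_inv_antipode)

text \<open>\<open>double_mult\<close> evaluates at chosen representatives of both factors. The one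
  for \<open>1 \<bowtie> \<epsilon>\<close> is exchanged for the pure tensor, then the one for the
  right factor for \<open>y\<close>; each exchange needs linearity modulo the relations.\<close>

lemma double_proj_coset:
  assumes "Poly_Mapping.keys y \<subseteq> UNIV \<times> dual scale"
  shows "double_proj scale \<Delta> \<epsilon> S (coset (double_rel scale) y)
    = coset (double_rel scale) (lin_ext free_scale (\<lambda>(l, g). proj_gen l g) y)"
proof -
  let ?Y = "rep (coset (double_rel scale) y)" and ?E = "rep (bowtie scale 1 \<epsilon>)"
  \<comment> \<open>A representative of the product of \<open>h \<bowtie> f\<close> and
    \<open>l \<bowtie> g\<close>, read off from \<open>double_mult\<close>.\<close>
  define M where "M h f l g = sw3 free_scale (\<lambda>a b c. Poly_Mapping.single
      (h * b, conv \<Delta> (right_act (left_act (inv S a) f) c) g) (1 :: 'k)) l" for h f l g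
  have Y: "?Y - y \<in> double_rel scale"
    by (rule DR.rep_coset)
  \<comment> \<open>Linearity of \<open>M\<close> in \<open>h\<close> and \<open>f\<close> is
    available for \<open>g\<close> in the dual, so the chosen representative must be supported there
    too.\<close>
  have "Poly_Mapping.keys ?Y \<subseteq> Poly_Mapping.keys (?Y - y) \<union> Poly_Mapping.keys y"
    using Poly_Mapping.keys_add[of "?Y - y" y] by simp
  with keys_double_rel[OF Y] assms have keys: "Poly_Mapping.keys ?Y \<subseteq> UNIV \<times> dual scale"
    by blast
  have M_h: "lin_mod scale UNIV free_scale (double_rel scale) (\<lambda>h. M h f l g)"
    if "f \<in> dual scale" "g \<in> dual scale" for f l g
    unfolding M_def sw3_def using that
    by (intro D.lin_mod_sw D.lin_mod_comp_right lin_mod_single_left) simp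
  have add: "right_act (left_act a (f + f')) c
      = right_act (left_act a f) c + right_act (left_act a f') c" for a c and f f' :: "'h \<Rightarrow> 'k"
    by (simp add: fun_eq_iff left_act_def right_act_def)
  have scale: "right_act (left_act a (dual_scale d f)) c
      = dual_scale d (right_act (left_act a f) c)" for a c d and f :: "'h \<Rightarrow> 'k"
    by (simp add: fun_eq_iff left_act_def right_act_def dual_scale_def)
  have M_f: "lin_mod dual_scale (dual scale) free_scale (double_rel scale) (\<lambda>f. M h f l g)"
    if "g \<in> dual scale" for h l g
    unfolding M_def sw3_def using that
    by (intro D.lin_mod_sw lin_mod_comp[OF lin_mod_single_right])
      (simp_all add: conv_linear add scale)
  have M_proj: "M 1 \<epsilon> l g = proj_gen l g" for l g
    by (simp add: M_def proj_gen_def counit_act_inv_antipode)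
  have "D.M.eqv (lin_ext free_scale (\<lambda>(h, f). lin_ext free_scale (\<lambda>(l, g). M h f l g) ?Y) ?E)
      (lin_ext free_scale (\<lambda>(h, f). lin_ext free_scale (\<lambda>(l, g). M h f l g) ?Y)
        (Poly_Mapping.single (1, \<epsilon>) 1))"
    using keys
    by (intro lin_ext_double_rel D.M.lin_mod_lin_ext)
      (auto simp: bowtie_def DR.rep_coset intro!: M_h M_f)
  also have "lin_ext free_scale (\<lambda>(h, f). lin_ext free_scale (\<lambda>(l, g). M h f l g) ?Y)
        (Poly_Mapping.single (1, \<epsilon>) 1) = lin_ext free_scale (\<lambda>(l, g). proj_gen l g) ?Y"
    unfolding M_proj[symmetric] by (simp add: module_free_scale)
  also have "D.M.eqv \<dots> (lin_ext free_scale (\<lambda>(l, g). proj_gen l g) y)"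
    by (rule lin_ext_double_rel[OF lin_mod_proj_gen_left lin_mod_proj_gen_right Y])
  finally have "coset (double_rel scale)
        (lin_ext free_scale (\<lambda>(h, f). lin_ext free_scale (\<lambda>(l, g). M h f l g) ?Y) ?E)
      = coset (double_rel scale) (lin_ext free_scale (\<lambda>(l, g). proj_gen l g) y)"
    by (simp add: DR.coset_eq_iff D.M.eqv_def)
  then show ?thesis
    by (simp add: double_proj_def double_mult_def t_lift_def M_def
        lin_ext_comul3[OF module_free_scale])
qed

text \<open>In the iterated coproduct of \<open>h * z\<close> the factor \<open>z\<close> sits on
  the first leg and passes through \<open>eps_t_cop\<close>; it then splits off as a convolution
  factor, because \<open>eps_t_cop a\<close> lies in \<open>H\<^sub>t\<close>.\<close>

lemma proj_gen_target:
  assumes z: "z \<in> target_space scale \<Delta> \<epsilon>" and f: "f \<in> dual scale"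
  shows "D.M.eqv (proj_gen (h * z) f) (proj_gen h (conv \<Delta> (left_act z \<epsilon>) f))"
proof -
  have "conv \<Delta> (counit_act (eps_t_cop (a * z)) c) f
      = conv \<Delta> (counit_act (eps_t_cop a) c) (conv \<Delta> (left_act z \<epsilon>) f)" for a c
    using conv_act_left_act_counit[OF eps_t_cop_in_target, of a c z] f
    by (simp add: eps_t_cop_mult_target[OF z] flip: conv_assoc)
  then show ?thesis
    using D.sw3_mult_target[OF trilin_proj_gen[OF f] z, of h] by (simp add: proj_gen_def)
qed

text \<open>Now \<open>y\<close> sits on the third leg and splits off by
  \<open>conv_act_right_act_counit\<close>.\<close>

lemma proj_gen_source:
  assumes y: "y \<in> source_space scale \<Delta> \<epsilon>" and f: "f \<in> dual scale"
  shows "D.M.eqv (proj_gen (h * y) f) (proj_gen h (conv \<Delta> (right_act \<epsilon> y) f))"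
proof -
  have "conv \<Delta> (counit_act (eps_t_cop a) (c * y)) f
      = conv \<Delta> (counit_act (eps_t_cop a) c) (conv \<Delta> (right_act \<epsilon> y) f)" for a c
    using conv_act_right_act_counit[OF y, of "eps_t_cop a" c] f by (simp flip: conv_assoc)
  then show ?thesis
    using D.sw3_mult_source[OF trilin_proj_gen[OF f] y, of h] by (simp add: proj_gen_def)
qed

lemma proj_span_ker_gens:
  assumes "x \<in> free_module.span (double_rel scale \<union> ker_gens)"
  shows "lin_ext free_scale (\<lambda>(l, g). proj_gen l g) x \<in> double_rel scale"
  using assms
proof (rule D.M.lin_ext_span_in)
  interpret P: module_hom free_scale free_scale "lin_ext free_scale (\<lambda>(l, g). proj_gen l g)"
    by (rule lin_ext_linear[OF module_free_scale])
  fix x assume "x \<in> double_rel scale \<union> ker_gens"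
  then show "lin_ext free_scale (\<lambda>(l, g). proj_gen l g) x \<in> double_rel scale"
  proof
    assume "x \<in> double_rel scale"
    then show ?thesis
      using lin_ext_double_rel[OF lin_mod_proj_gen_left lin_mod_proj_gen_right, of x 0]
      by (simp add: D.M.eqv_def P.zero)
  next
    assume "x \<in> ker_gens"
    then show ?thesis
      using proj_gen_target proj_gen_source
      by (auto simp: ker_gens_def P.diff module_free_scale D.M.eqv_def)
  qed
qed

text \<open>Modulo the span the generators are rewriting rules that carry factors of the left
  component into the functional. They are applied to \<open>l\<close> written as
  \<open>l\<^sub>2 T l\<^sub>1 \<epsilon>\<^sub>s l\<^sub>3\<close>.\<close>

lemma sub_proj_gen:
  assumes g: "g \<in> dual scale"
  shows "Poly_Mapping.single (l, g) 1 - proj_gen l g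
    \<in> free_module.span (double_rel scale \<union> ker_gens)"
proof -
  let ?J = "free_module.span (double_rel scale \<union> ker_gens)"
  interpret J: weak_bialgebra_mod scale \<Delta> \<epsilon> free_scale ?J
    by (simp add: weak_bialgebra_mod_def weak_bialgebra_axioms module_mod_def
        module_mod_axioms_def module_free_scale)
  let ?T = eps_t_cop and ?s = "eps_s scale \<Delta> \<epsilon>"
  have target: "J.M.eqv (Poly_Mapping.single (h * z, f) 1)
      (Poly_Mapping.single (h, conv \<Delta> (left_act z \<epsilon>) f) 1)"
    if "z \<in> target_space scale \<Delta> \<epsilon>" "f \<in> dual scale" for h z f
    unfolding J.M.eqv_def using that by (intro free_module.span_base) (auto simp: ker_gens_def)
  have source: "J.M.eqv (Poly_Mapping.single (h * y, f) 1)
      (Poly_Mapping.single (h, conv \<Delta> (right_act \<epsilon> y) f) 1)"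
    if "y \<in> source_space scale \<Delta> \<epsilon>" "f \<in> dual scale" for h y f
    unfolding J.M.eqv_def using that by (intro free_module.span_base) (auto simp: ker_gens_def)
  have lin: "lin_mod scale UNIV free_scale ?J (\<lambda>a. Poly_Mapping.single (a, g) 1)"
    by (rule lin_mod_mono[OF lin_mod_single_left[OF g]]) (auto intro: free_module.span_base)
  \<comment> \<open>The functional \<open>\<epsilon> \<leftharpoonup> c\<close> depends on
    \<open>c\<close> only through its image in \<open>H\<^sub>s\<close>, so the rule for
    \<open>H\<^sub>s\<close> becomes applicable.\<close>
  have act: "conv \<Delta> (counit_act z c) g
      = conv \<Delta> (left_act z \<epsilon>) (conv \<Delta> (right_act \<epsilon> (?s c)) g)" for z c
  proof -
    have "right_act \<epsilon> (?s c) = right_act \<epsilon> c"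
      by (simp add: fun_eq_iff right_act_def counit_eps_s_mult)
    then show ?thesis
      using g by (simp add: conv_left_right_act_counit flip: conv_assoc)
  qed
  \<comment> \<open>The rightmost factor \<open>?s c\<close> crosses first, then
    \<open>?T a\<close>.\<close>
  have step: "J.M.eqv (Poly_Mapping.single (b * ?T a * ?s c, g) 1)
      (Poly_Mapping.single (b, conv \<Delta> (counit_act (?T a) c) g) 1)" for a b c
    using J.M.eqv_trans[OF source[of "?s c" g "b * ?T a"]
        target[of "?T a" "conv \<Delta> (right_act \<epsilon> (?s c)) g" b]]
    by (simp only: act g eps_s_source eps_t_cop_in_target conv_dual right_act_dual counit_dual)
  \<comment> \<open>The inner sum over the two halves of the left leg gives back that leg;
    \<open>sw_eps_s\<close> then finishes.\<close>
  have "sw3 scale (\<lambda>a b c. b * ?T a * ?s c) l = sw scale (\<lambda>a c. a * ?s c) l"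
    by (simp add: sw3_def sw_eps_t_cop flip: sw_mult_right)
  then have "J.M.eqv (Poly_Mapping.single (l, g) 1)
      (sw3 free_scale (\<lambda>a b c. Poly_Mapping.single (b * ?T a * ?s c, g) 1) l)"
    using J.sw3_apply[OF lin, of "\<lambda>a b c. b * ?T a * ?s c" l] by (simp add: sw_eps_s)
  then have "J.M.eqv (Poly_Mapping.single (l, g) 1) (proj_gen l g)"
    unfolding proj_gen_def by (rule J.M.eqv_trans[OF _ J.sw3_eqv[OF step]])
  then show ?thesis by (simp only: J.M.eqv_def)
qed

lemma sub_proj:
  assumes "Poly_Mapping.keys x \<subseteq> UNIV \<times> dual scale"
  shows "x - lin_ext free_scale (\<lambda>(l, g). proj_gen l g) x
    \<in> free_module.span (double_rel scale \<union> ker_gens)"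
proof -
  let ?J = "free_module.span (double_rel scale \<union> ker_gens)"
  interpret J: module_mod free_scale ?J
    by (simp add: module_mod_def module_mod_axioms_def module_free_scale)
  \<comment> \<open>As a linear extension of the basis inclusion, \<open>x\<close> can be compared
    with its projection term by term over its support.\<close>
  have "x = lin_ext free_scale (\<lambda>i. Poly_Mapping.single i 1) x"
    by (rule poly_mapping_eqI) (simp add: lin_ext_def lookup_sum lookup_single when_def in_keys_iff
        sum.delta if_distrib cong: if_cong)
  also have "J.eqv \<dots> (lin_ext free_scale (\<lambda>(l, g). proj_gen l g) x)"
    using assms by (intro J.lin_ext_eqv) (auto simp: J.eqv_def intro!: sub_proj_gen)
  finally show ?thesis by (simp add: J.eqv_def)
qed

text \<open>If \<open>p y\<close> vanishes modulo the relations, then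
  \<open>y = (y - p y) + p y\<close> lies in the span. Conversely \<open>p\<close> kills the span,
  whose support is admissible.\<close>

lemma double_ker_eq:
  "double_ker scale \<Delta> \<epsilon> S = coset (double_rel scale) ` free_module.span (double_rel scale \<union> ker_gens)"
proof safe
  fix X assume "X \<in> double_ker scale \<Delta> \<epsilon> S"
  then obtain y where X: "X = coset (double_rel scale) y"
    and y: "Poly_Mapping.keys y \<subseteq> UNIV \<times> dual scale"
    and "double_proj scale \<Delta> \<epsilon> S X = coset (double_rel scale) 0"
    by (auto simp: double_ker_def double_carrier_def tensor2_def double_rel_def)
  then have "lin_ext free_scale (\<lambda>(l, g). proj_gen l g) y \<in> double_rel scale"
    by (simp add: double_proj_coset DR.coset_eq_iff)
  then have "y \<in> free_module.span (double_rel scale \<union> ker_gens)"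
    using free_module.span_add[OF sub_proj[OF y] free_module.span_base[OF UnI1],
        of "lin_ext free_scale (\<lambda>(l, g). proj_gen l g) y"] by (simp only: diff_add_cancel)
  then show "X \<in> coset (double_rel scale) ` free_module.span (double_rel scale \<union> ker_gens)"
    using X by blast
next
  fix y assume y: "y \<in> free_module.span (double_rel scale \<union> ker_gens)"
  then show "coset (double_rel scale) y \<in> double_ker scale \<Delta> \<epsilon> S"
    using keys_span_ker_gens[OF y] proj_span_ker_gens[OF y]
    by (auto simp: double_ker_def double_carrier_def tensor2_def double_proj_coset DR.coset_eq_iff
        simp flip: double_rel_def)
qed

end

end

theorem proposition4p3:
  fixes scale :: "'k::comm_ring_1 \<Rightarrow> 'h \<Rightarrow> 'h::{ring, monoid_mult}"
    and \<Delta> :: "'h \<Rightarrow> ('h \<times> 'h \<Rightarrow>\<^sub>0 'k) set"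
    and \<epsilon> :: "'h \<Rightarrow> 'k"
    and S :: "'h \<Rightarrow> 'h"
  assumes "weak_hopf_algebra scale \<Delta> \<epsilon> S"
    and "bij S"
    and "finitely_generated scale"
    and "projective_module scale"
  shows "double_ker scale \<Delta> \<epsilon> S =
    q_span (double_rel scale)
      ({q_diff (double_rel scale)
          (bowtie scale (h * z) f)
          (bowtie scale h (conv \<Delta> (left_act z \<epsilon>) f)) | h f z.
          f \<in> dual scale \<and> z \<in> target_space scale \<Delta> \<epsilon>}
     \<union> {q_diff (double_rel scale)
          (bowtie scale (h * y) f)
          (bowtie scale h (conv \<Delta> (right_act \<epsilon> y) f)) | h f y.
          f \<in> dual scale \<and> y \<in> source_space scale \<Delta> \<epsilon>})"
    (is "_ = q_span _ ?G")
proof -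
  interpret weak_hopf_algebra scale \<Delta> \<epsilon> S by fact
  \<comment> \<open>A difference of pure tensors is the coset of the difference of their
    representatives, so \<open>?G\<close> consists of cosets and \<open>q_span_cosets\<close>
    applies.\<close>
  have "?G = coset (double_rel scale) ` ker_gens"
    unfolding ker_gens_def image_Un bowtie_def DR.q_diff_coset by blast
  then show ?thesis
    by (simp only: double_ker_eq[OF \<open>bij S\<close>] DR.q_span_cosets)
qed

end
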